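(* Let $\mathfrak m\in\mathbb R$, suppose that $F:\mathbb R\to\mathbb R$ belongs to $S$, and let $f(t,u)=t^{-3/2}F(t^{1/2}u)$ for $t>0$, $u\in\mathbb R$. For $\varepsilon\in(0,1)$ let $\sigma_\varepsilon$ be the unique solution to $$\dot\sigma_\varepsilon(t)=-\frac1{\log\varepsilon^{-1}}\mathbb E\big[f'(t+\varepsilon^2,\sigma_\varepsilon(t)\,G^{\mathfrak m}_t*\eta_\varepsilon(x))\big]\sigma_\varepsilon(t),\qquad\sigma_\varepsilon(0)=1,$$ (the expectation does not depend on $x\in\mathbb R^2$), and define $\bar\sigma_\varepsilon(q)=\sigma_\varepsilon(\varepsilon^{2-q}-\varepsilon^2)$. Then $$\lim_{\varepsilon\to0}\ \sup_{q\in[0,2]}|\bar\sigma_\varepsilon(q)-\bar\sigma(q)|=0,$$ where $\bar\sigma$ is the unique solution to the ODE problem $$\dot{\bar\sigma}(q)=-\mathbb E\big[F'(\bar\sigma(q)\,G_1*\eta(0))\big]\bar\sigma(q),\qquad\bar\sigma(0)=1.$$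
   Context: $\eta$ is a spatial white noise on $\mathbb R^2$; $G_t(x)=\frac1{2\pi t}e^{-|x|^2/(2t)}$, $G^{\mathfrak m}_t=e^{\mathfrak m t}G_t$; $*$ is spatial convolution; $\eta_\varepsilon=G_{\varepsilon^2}*\eta$. $f'$ denotes $\partial_uf$. $\mathrm{Lip}$ denotes the Lipschitz constant. Class $S$ (for functions $F(t,u)$ on $(0,\infty)\times\mathbb R$; here $F$ does not depend on $t$, and it is regarded as such a function): - For $L_1,L_2\ge0$, $F\in S_1(L_1,L_2)$ if $F$ is continuous and for each $t>0$, $F(t,\cdot)$ is odd and differentiable with $\mathrm{Lip}(F(t,\cdot))\le L_1$ and $\mathrm{Lip}(F'(t,\cdot))\le L_2$. $S_1=\bigcup_{L_1,L_2\in[0,\infty)}S_1(L_1,L_2)$. - For $\gamma_1\ge2$, $\gamma_2\ge1$, $\ell_1,\ell_2\ge0$, $F\in S_2(\gamma_1,\gamma_2,\ell_1,\ell_2)$ if $F$ is continuous and for each $t>0$, $F(t,\cdot)$ is odd, differentiable and increasing with locally Lipschitz derivative, and for all $u\ge0$, $\mathrm{Lip}(F(t,\cdot)|_{[0,u]})\le\ell_1(1+|u|^{\gamma_1})$ and $\mathrm{Lip}(F'(t,\cdot)|_{[0,u]})\le\ell_2(1+|u|^{\gamma_2})$. $S_2$ is the union of these over all $\gamma_1\in[2,\infty)$, $\gamma_2\in[1,\infty)$, $\ell_1,\ell_2\in[0,\infty)$. - $S$ is the set of $F=F_1+F_2$ with $F_1\in S_1$ and $F_2\in S_2$. *)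

theory Defs
  imports "HOL-Probability.Probability"
begin

section \<open>The class of nonlinearities\<close>

text \<open>Functions of \<open>(t, u)\<close> on \<open>(0, \<infinity>) \<times> \<real>\<close> are total curried functions; their values at
  \<open>t \<le> 0\<close> are never used.  A Lipschitz constant being at most \<open>L\<close> is the library predicate
  \<open>L-lipschitz_on\<close>.\<close>

definition odd_fun :: "(real \<Rightarrow> real) \<Rightarrow> bool" where
  "odd_fun g \<longleftrightarrow> (\<forall>u. g (- u) = - g u)"

definition locally_lipschitz :: "(real \<Rightarrow> real) \<Rightarrow> bool" where
  "locally_lipschitz g \<longleftrightarrow> (\<forall>u. \<exists>r>0. \<exists>L. L-lipschitz_on (ball u r) g)"

definition class_S1_with :: "real \<Rightarrow> real \<Rightarrow> (real \<Rightarrow> real \<Rightarrow> real) set" where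
  "class_S1_with L1 L2 = {F.
     continuous_on ({0<..} \<times> UNIV) (\<lambda>(t, u). F t u) \<and>
     (\<forall>t>0. odd_fun (F t) \<and> F t differentiable_on UNIV \<and>
        L1-lipschitz_on UNIV (F t) \<and> L2-lipschitz_on UNIV (deriv (F t)))}"

definition class_S1 :: "(real \<Rightarrow> real \<Rightarrow> real) set" where
  "class_S1 = (\<Union>L1\<in>{0..}. \<Union>L2\<in>{0..}. class_S1_with L1 L2)"

text \<open>``Increasing'' is read as non-decreasing.  With the strict reading the class \<open>class_S\<close> below
  would be the same, because \<open>u\<close> can be added to the second summand and subtracted from the first.\<close>

definition class_S2_with ::
    "real \<Rightarrow> real \<Rightarrow> real \<Rightarrow> real \<Rightarrow> (real \<Rightarrow> real \<Rightarrow> real) set" where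
  "class_S2_with \<gamma>1 \<gamma>2 l1 l2 = {F.
     continuous_on ({0<..} \<times> UNIV) (\<lambda>(t, u). F t u) \<and>
     (\<forall>t>0. odd_fun (F t) \<and> F t differentiable_on UNIV \<and> mono (F t) \<and>
        locally_lipschitz (deriv (F t)) \<and>
        (\<forall>u\<ge>0. (l1 * (1 + \<bar>u\<bar> powr \<gamma>1))-lipschitz_on {0..u} (F t) \<and>
               (l2 * (1 + \<bar>u\<bar> powr \<gamma>2))-lipschitz_on {0..u} (deriv (F t))))}"

definition class_S2 :: "(real \<Rightarrow> real \<Rightarrow> real) set" where
  "class_S2 = (\<Union>\<gamma>1\<in>{2..}. \<Union>\<gamma>2\<in>{1..}. \<Union>l1\<in>{0..}. \<Union>l2\<in>{0..}. class_S2_with \<gamma>1 \<gamma>2 l1 l2)"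

definition class_S :: "(real \<Rightarrow> real \<Rightarrow> real) set" where
  "class_S = {F. \<exists>F1\<in>class_S1. \<exists>F2\<in>class_S2. \<forall>t>0. \<forall>u. F t u = F1 t u + F2 t u}"

definition rescaled :: "(real \<Rightarrow> real) \<Rightarrow> real \<Rightarrow> real \<Rightarrow> real" where
  "rescaled F t u = t powr (- 3/2) * F (t powr (1/2) * u)"


section \<open>Tempered distributions and white noise\<close>

primrec iterated_partial ::
    "'a list \<Rightarrow> ('a::euclidean_space \<Rightarrow> real) \<Rightarrow> 'a \<Rightarrow> real" where
  "iterated_partial [] \<phi> = \<phi>"
| "iterated_partial (v # vs) \<phi> = (\<lambda>x. frechet_derivative (iterated_partial vs \<phi>) (at x) v)"

definition schwartz :: "('a::euclidean_space \<Rightarrow> real) set" where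
  "schwartz = {\<phi>. \<forall>vs\<in>lists Basis. iterated_partial vs \<phi> differentiable_on UNIV \<and>
     (\<forall>k::nat. bounded (range (\<lambda>x. norm x ^ k * iterated_partial vs \<phi> x)))}"

text \<open>Convergence of \<open>\<phi> n\<close> to \<open>\<psi>\<close> in every Schwartz seminorm.\<close>

definition schwartz_tendsto ::
    "(nat \<Rightarrow> 'a::euclidean_space \<Rightarrow> real) \<Rightarrow> ('a \<Rightarrow> real) \<Rightarrow> bool" where
  "schwartz_tendsto \<phi> \<psi> \<longleftrightarrow> (\<forall>vs\<in>lists Basis. \<forall>k::nat.
     uniform_limit UNIV (\<lambda>n x. norm x ^ k * iterated_partial vs (\<phi> n) x)
       (\<lambda>x. norm x ^ k * iterated_partial vs \<psi> x) sequentially)"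

text \<open>The Schwartz space is metrizable, so continuity of a linear functional is sequential
  continuity.  Values of a functional outside \<open>schwartz\<close> are irrelevant.\<close>

definition tempered_distribution :: "(('a::euclidean_space \<Rightarrow> real) \<Rightarrow> real) \<Rightarrow> bool" where
  "tempered_distribution T \<longleftrightarrow>
     (\<forall>\<phi>\<in>schwartz. \<forall>\<psi>\<in>schwartz. \<forall>a b. T (\<lambda>x. a * \<phi> x + b * \<psi> x) = a * T \<phi> + b * T \<psi>) \<and>
     (\<forall>\<phi> \<psi>. (\<forall>n. \<phi> n \<in> schwartz) \<longrightarrow> \<psi> \<in> schwartz \<longrightarrow> schwartz_tendsto \<phi> \<psi> \<longrightarrow>
        (\<lambda>n. T (\<phi> n)) \<longlonglongrightarrow> T \<psi>)"

text \<open>White noise: a random tempered distribution whose pairing with each test function \<open>\<phi>\<close> is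
  centred Gaussian with variance \<open>\<parallel>\<phi>\<parallel>\<^sup>2\<close> in \<open>L\<^sup>2\<close>.  By linearity and polarization the pairings are then
  jointly Gaussian with covariance the \<open>L\<^sup>2\<close> inner product.  The test function \<open>0\<close> is exempted only because
  \<open>normal_density\<close> needs a positive standard deviation; there the pairing is \<open>0\<close> by linearity.\<close>

definition white_noise ::
    "'w measure \<Rightarrow> ('w \<Rightarrow> ('a::euclidean_space \<Rightarrow> real) \<Rightarrow> real) \<Rightarrow> bool" where
  "white_noise M \<eta> \<longleftrightarrow> prob_space M \<and>
     (\<forall>\<omega>\<in>space M. tempered_distribution (\<eta> \<omega>)) \<and>
     (\<forall>\<phi>\<in>schwartz. \<phi> \<noteq> (\<lambda>x. 0) \<longrightarrow>
        distributed M lborel (\<lambda>\<omega>. \<eta> \<omega> \<phi>)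
          (normal_density 0 (sqrt (\<integral>x. (\<phi> x)\<^sup>2 \<partial>lborel))))"


section \<open>Heat kernels and convolutions\<close>

type_synonym plane = "real \<times> real"

definition heat_kernel :: "real \<Rightarrow> plane \<Rightarrow> real" where
  "heat_kernel t x = 1 / (2 * pi * t) * exp (- (norm x)\<^sup>2 / (2 * t))"

definition massive_heat_kernel :: "real \<Rightarrow> real \<Rightarrow> plane \<Rightarrow> real" where
  "massive_heat_kernel m t x = exp (m * t) * heat_kernel t x"

definition conv :: "(plane \<Rightarrow> real) \<Rightarrow> (plane \<Rightarrow> real) \<Rightarrow> plane \<Rightarrow> real" where
  "conv g h x = (\<integral>y. g (x - y) * h y \<partial>lborel)"

definition conv_distr :: "(plane \<Rightarrow> real) \<Rightarrow> ((plane \<Rightarrow> real) \<Rightarrow> real) \<Rightarrow> plane \<Rightarrow> real" where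
  "conv_distr g T x = T (\<lambda>y. g (x - y))"

definition mollified :: "real \<Rightarrow> ((plane \<Rightarrow> real) \<Rightarrow> real) \<Rightarrow> plane \<Rightarrow> real" where
  "mollified \<epsilon> T = conv_distr (heat_kernel (\<epsilon>\<^sup>2)) T"

text \<open>Convolution with the massive heat kernel at time \<open>t \<ge> 0\<close>; at \<open>t = 0\<close> the kernel is the
  Dirac mass at the origin.\<close>

definition heat_flow :: "real \<Rightarrow> real \<Rightarrow> (plane \<Rightarrow> real) \<Rightarrow> plane \<Rightarrow> real" where
  "heat_flow m t h = (if t = 0 then h else conv (massive_heat_kernel m t) h)"


section \<open>The two initial value problems\<close>

text \<open>\<open>mean_slope\<close> is the expectation
  \<open>\<bbbE>[f'(t + \<epsilon>\<^sup>2, a G\<^sup>m\<^sub>t * \<eta>\<^sub>\<epsilon>(x))]\<close>, with the derivative taken in the second argument of \<open>f\<close>.\<close>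

definition mean_slope ::
    "'w measure \<Rightarrow> ('w \<Rightarrow> (plane \<Rightarrow> real) \<Rightarrow> real) \<Rightarrow> real \<Rightarrow> (real \<Rightarrow> real) \<Rightarrow>
     plane \<Rightarrow> real \<Rightarrow> real \<Rightarrow> real \<Rightarrow> real" where
  "mean_slope M \<eta> m F x \<epsilon> t a =
     (\<integral>\<omega>. deriv (rescaled F (t + \<epsilon>\<^sup>2)) (a * heat_flow m t (mollified \<epsilon> (\<eta> \<omega>)) x) \<partial>M)"

definition solves_sigma_eps ::
    "'w measure \<Rightarrow> ('w \<Rightarrow> (plane \<Rightarrow> real) \<Rightarrow> real) \<Rightarrow> real \<Rightarrow> (real \<Rightarrow> real) \<Rightarrow>
     plane \<Rightarrow> real \<Rightarrow> (real \<Rightarrow> real) \<Rightarrow> bool" where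
  "solves_sigma_eps M \<eta> m F x \<epsilon> \<sigma> \<longleftrightarrow> \<sigma> 0 = 1 \<and>
     (\<forall>t\<ge>0. (\<sigma> has_real_derivative
        - (1 / ln (inverse \<epsilon>)) * mean_slope M \<eta> m F x \<epsilon> t (\<sigma> t) * \<sigma> t) (at t within {0..}))"

definition solves_sigma_bar ::
    "'w measure \<Rightarrow> ('w \<Rightarrow> (plane \<Rightarrow> real) \<Rightarrow> real) \<Rightarrow> (real \<Rightarrow> real) \<Rightarrow>
     (real \<Rightarrow> real) \<Rightarrow> bool" where
  "solves_sigma_bar M \<eta> F \<sigma> \<longleftrightarrow> \<sigma> 0 = 1 \<and>
     (\<forall>q\<ge>0. (\<sigma> has_real_derivative
        - (\<integral>\<omega>. deriv F (\<sigma> q * conv_distr (heat_kernel 1) (\<eta> \<omega>) 0) \<partial>M) * \<sigma> q)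
        (at q within {0..}))"

text \<open>Unique solution on \<open>[0, \<infinity>)\<close>; values at negative times carry no information.\<close>

definition unique_solution :: "((real \<Rightarrow> real) \<Rightarrow> bool) \<Rightarrow> (real \<Rightarrow> real) \<Rightarrow> bool" where
  "unique_solution P \<sigma> \<longleftrightarrow> P \<sigma> \<and> (\<forall>\<tau>. P \<tau> \<longrightarrow> (\<forall>t\<ge>0. \<tau> t = \<sigma> t))"

end

theory Submission
  imports Defs
begin

text \<open>Write \<open>G_s\<close> for the heat kernel and \<open>\<eta>(\<phi>)\<close> for the pairing of the noise with a test function.
  Convolving the mollified noise with the heat kernel only widens the kernel: almost surely
  \<open>G^m_t * \<eta>_\<epsilon>(x) = e^(mt) \<eta>(G_(t + \<epsilon>\<^sup>2)(x - \<cdot>))\<close>, a centred Gaussian of variance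
  \<open>e^(2mt) / (4\<pi>(t + \<epsilon>\<^sup>2))\<close>.  Since \<open>f'(s, u) = F'(s^(1/2) u) / s\<close>, the factor \<open>s^(1/2)\<close> with
  \<open>s = t + \<epsilon>\<^sup>2\<close> cancels this variance, and
  \<open>E f'(t + \<epsilon>\<^sup>2, a G^m_t * \<eta>_\<epsilon>(x)) = H(e^(mt) a) / (t + \<epsilon>\<^sup>2)\<close>, where \<open>H(b) = E F'(b G_1 * \<eta>(0))\<close>
  (\<open>mean_slope_eq_gaussian_mean\<close>).  This does not involve \<open>x\<close>, and \<open>H\<close> is the function that drives the
  limiting equation \<open>\<sigma>' = - H(\<sigma>) \<sigma>\<close>.

  In the clock \<open>q\<close> defined by \<open>t + \<epsilon>\<^sup>2 = \<epsilon>^(2 - q)\<close> one has \<open>dt / ((t + \<epsilon>\<^sup>2) log(1/\<epsilon>)) = dq\<close>, so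
  \<open>y(q) = \<sigma>_\<epsilon>(\<epsilon>^(2 - q) - \<epsilon>\<^sup>2)\<close> solves \<open>y' = - H(e^(mt) y) y\<close> with \<open>y(0) = 1\<close>.  Only the factor
  \<open>e^(mt)\<close> separates this from the limiting equation, and
  \<open>\<bar>e^(mt) - 1\<bar> \<le> \<bar>m\<bar> e^\<bar>m\<bar> \<epsilon>^(2 - q)\<close>, whose integral over \<open>0 \<le> q \<le> 2\<close> is \<open>O(1 / log(1/\<epsilon>))\<close>.
  The Gronwall inequality therefore bounds the supremum of the difference by a constant multiple of
  \<open>1 / log(1/\<epsilon>)\<close> (\<open>solution_distance\<close>).

  Two properties of \<open>F\<close> enter.  Its derivative is bounded below, because one summand of \<open>F\<close> is
  Lipschitz and the other is non-decreasing; hence \<open>H \<ge> - K\<close>, solutions stay in \<open>(0, e^(Kq)]\<close>, and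
  they are global although \<open>H\<close> is only locally Lipschitz (\<open>ex_unique_solution\<close>).  And the local
  Lipschitz constants of \<open>F'\<close> grow polynomially, so that Gaussian moments turn them into local
  Lipschitz constants of \<open>H\<close> (\<open>gaussian_mean_poly_lipschitz\<close>).

  The formula for the heat flow of the noise is proved in mean square instead of by exchanging a
  distribution with an integral.  The random variables \<open>\<eta>(G_s(a - \<cdot>))\<close> have covariances given by heat
  kernels, so by the semigroup property the average of \<open>\<eta>(G_s(y - \<cdot>))\<close> over \<open>y\<close> with weight
  \<open>G_t(x - y)\<close> has the same covariances as \<open>\<eta>(G_(s + t)(x - \<cdot>))\<close>, and the two are equal almost surely
  (\<open>random_average_eq_projection\<close>, \<open>heat_average_smoothed\<close>).\<close>


section \<open>Polynomials times Gaussians as test functions\<close>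

lemma real_polynomial_function_has_derivative:
  fixes p :: "'a::euclidean_space \<Rightarrow> real"
  assumes "real_polynomial_function p"
  shows "\<exists>D. (\<forall>x. (p has_derivative D x) (at x)) \<and> (\<forall>v. real_polynomial_function (\<lambda>x. D x v))"
  using assms
proof induction
  case (linear f)
  then show ?case
    by (intro exI[of _ "\<lambda>x. f"]) (auto intro: bounded_linear_imp_has_derivative)
next
  case (const c)
  show ?case
    by (intro exI[of _ "\<lambda>x v. 0"]) (auto intro: real_polynomial_function.intros(2))
next
  case (add f g)
  then obtain D E where "\<forall>x. (f has_derivative D x) (at x)" "\<forall>v. real_polynomial_function (\<lambda>x. D x v)"
    "\<forall>x. (g has_derivative E x) (at x)" "\<forall>v. real_polynomial_function (\<lambda>x. E x v)" by blast
  then show ?case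
    by (intro exI[of _ "\<lambda>x v. D x v + E x v"] conjI allI has_derivative_add
         real_polynomial_function.intros(3)) auto
next
  case (mult f g)
  then obtain D E where "\<forall>x. (f has_derivative D x) (at x)" "\<forall>v. real_polynomial_function (\<lambda>x. D x v)"
    "\<forall>x. (g has_derivative E x) (at x)" "\<forall>v. real_polynomial_function (\<lambda>x. E x v)" by blast
  then show ?case using mult.hyps
    by (intro exI[of _ "\<lambda>x v. f x * E x v + D x v * g x"] conjI allI has_derivative_mult
         real_polynomial_function.intros(3) real_polynomial_function.intros(4)) auto
qed

lemma real_polynomial_function_growth:
  fixes p :: "'a::euclidean_space \<Rightarrow> real"
  assumes "real_polynomial_function p"
  shows "\<exists>C n. C \<ge> 0 \<and> (\<forall>x. \<bar>p x\<bar> \<le> C * (1 + norm x) ^ n)"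
  using assms
proof induction
  case (linear f)
  then obtain K where K: "\<forall>x. norm (f x) \<le> norm x * K" "K > 0"
    using bounded_linear.pos_bounded by blast
  have "\<bar>f x\<bar> \<le> K * (1 + norm x) ^ 1" for x
  proof -
    have "\<bar>f x\<bar> \<le> K * norm x" using K(1) by (simp add: mult.commute)
    also have "\<dots> \<le> K * (1 + norm x) ^ 1" using K(2) by simp
    finally show ?thesis .
  qed
  with K show ?case by (meson less_imp_le)
next
  case (const c)
  show ?case by (intro exI[of _ "\<bar>c\<bar>"] exI[of _ 0]) auto
next
  case (add f g)
  then obtain C n B k where *: "C \<ge> 0" "\<And>x. \<bar>f x\<bar> \<le> C * (1 + norm x) ^ n"
     "B \<ge> 0" "\<And>x. \<bar>g x\<bar> \<le> B * (1 + norm x) ^ k" by blast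
  have "\<bar>f x + g x\<bar> \<le> (C + B) * (1 + norm x) ^ (n + k)" for x
  proof -
    have "C * (1 + norm x) ^ n \<le> C * (1 + norm x) ^ (n+k)" "B * (1 + norm x) ^ k \<le> B * (1 + norm x) ^ (n+k)"
      using * by (auto intro!: mult_left_mono power_increasing)
    with *(2)[of x] *(4)[of x] show ?thesis by (simp add: algebra_simps)
  qed
  with * show ?case by (intro exI[of _ "C+B"] exI[of _ "n+k"]) auto
next
  case (mult f g)
  then obtain C n B k where *: "C \<ge> 0" "\<And>x. \<bar>f x\<bar> \<le> C * (1 + norm x) ^ n"
     "B \<ge> 0" "\<And>x. \<bar>g x\<bar> \<le> B * (1 + norm x) ^ k" by blast
  have "\<bar>f x * g x\<bar> \<le> (C * B) * (1 + norm x) ^ (n + k)" for x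
  proof -
    have "\<bar>f x\<bar> * \<bar>g x\<bar> \<le> (C * (1 + norm x) ^ n) * (B * (1 + norm x) ^ k)"
      using * by (intro mult_mono) auto
    then show ?thesis by (simp add: abs_mult power_add mult_ac)
  qed
  with * show ?case by (intro exI[of _ "C*B"] exI[of _ "n+k"]) auto
qed

text \<open>This class contains the heat kernel and is stable under differentiation, so that all Schwartz
  seminorms of the heat kernel can be controlled by one decay estimate.\<close>

definition gaussian_polynomials :: "real \<Rightarrow> ('a::euclidean_space \<Rightarrow> real) set" where
  "gaussian_polynomials s =
     {\<lambda>x. p x * exp (- (norm x)\<^sup>2 / (2 * s)) |p. real_polynomial_function p}"

lemma gaussian_polynomials_has_derivative:
  fixes h :: "'a::euclidean_space \<Rightarrow> real"
  assumes "s > 0" "h \<in> gaussian_polynomials s"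
  shows "\<exists>D. (\<forall>x. (h has_derivative D x) (at x)) \<and> (\<forall>v. (\<lambda>x. D x v) \<in> gaussian_polynomials s)"
proof -
  obtain p where p: "real_polynomial_function p" "h = (\<lambda>x. p x * exp (- (norm x)\<^sup>2 / (2 * s)))"
    using assms by (auto simp: gaussian_polynomials_def)
  obtain D where D: "\<And>x. (p has_derivative D x) (at x)" "\<And>v. real_polynomial_function (\<lambda>x. D x v)"
    using real_polynomial_function_has_derivative[OF p(1)] by blast
  define E where "E = (\<lambda>x v. (D x v - p x * ((x \<bullet> v) / s)) * exp (- (norm x)\<^sup>2 / (2 * s)))"
  have "(h has_derivative E x) (at x)" for x
  proof -
    have "((\<lambda>x. - (x \<bullet> x) / (2 * s)) has_derivative (\<lambda>v. - ((x \<bullet> v) / s))) (at x)"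
      using assms(1)
      by (auto intro!: derivative_eq_intros simp: fun_eq_iff inner_commute field_simps)
    from has_derivative_mult[OF D(1) has_derivative_exp[OF this]] show ?thesis
      unfolding p(2) power2_norm_eq_inner E_def
      by (rule has_derivative_eq_rhs) (auto simp: fun_eq_iff algebra_simps)
  qed
  moreover have "(\<lambda>x. E x v) \<in> gaussian_polynomials s" for v
  proof -
    have "real_polynomial_function (\<lambda>x. D x v - p x * (1 / s * (x \<bullet> v)))"
      by (intro real_polynomial_function_diff real_polynomial_function.intros p D bounded_linear_inner_left)
    then show ?thesis unfolding gaussian_polynomials_def E_def by auto
  qed
  ultimately show ?thesis by blast
qed

text \<open>The Gaussian wins against any power: \<open>(1 + r)^N \<le> N! e^(1 + r)\<close> by one term of the exponential
  series, and \<open>r - r\<^sup>2 / (2s) \<le> s / 2\<close> by completing the square.\<close>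

lemma gaussian_polynomials_decay:
  fixes h :: "'a::euclidean_space \<Rightarrow> real"
  assumes "s > 0" "h \<in> gaussian_polynomials s"
  shows "\<exists>C\<ge>0. \<forall>x. (1 + norm x) ^ k * \<bar>h x\<bar> \<le> C"
proof -
  obtain p where p: "real_polynomial_function p" "h = (\<lambda>x. p x * exp (- (norm x)\<^sup>2 / (2 * s)))"
    using assms by (auto simp: gaussian_polynomials_def)
  obtain C n where C: "C \<ge> 0" "\<And>x. \<bar>p x\<bar> \<le> C * (1 + norm x) ^ n"
    using real_polynomial_function_growth[OF p(1)] by blast
  define N where "N = k + n"
  have "(1 + norm x) ^ k * \<bar>h x\<bar> \<le> C * (fact N * exp (1 + s / 2))" for x
  proof -
    let ?r = "norm x" and ?e = "exp (- (norm x)\<^sup>2 / (2 * s))"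
    have "(1 + ?r) ^ N / fact N \<le> (\<Sum>i\<le>N. (1 + ?r) ^ i / fact i)"
      by (rule member_le_sum) auto
    also have "\<dots> \<le> exp (1 + ?r)"
      using summable_exp[of "1 + ?r"]
      by (auto simp: exp_def divide_inverse mult.commute intro!: sum_le_suminf)
    finally have pow: "(1 + ?r) ^ N \<le> fact N * exp (1 + ?r)"
      by (simp add: field_simps)
    have "0 \<le> (?r - s)\<^sup>2" by simp
    then have "?r - ?r\<^sup>2 / (2 * s) \<le> s / 2"
      using assms(1) by (simp add: field_simps power2_eq_square)
    then have ex: "exp (1 + ?r) * ?e \<le> exp (1 + s / 2)"
      by (simp add: exp_add[symmetric])
    have "(1 + ?r) ^ k * \<bar>h x\<bar> = (1 + ?r) ^ k * \<bar>p x\<bar> * ?e"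
      by (simp add: p(2) abs_mult)
    also have "\<dots> \<le> (1 + ?r) ^ k * (C * (1 + ?r) ^ n) * ?e"
      using C by (intro mult_right_mono mult_left_mono) auto
    also have "\<dots> = C * ((1 + ?r) ^ N * ?e)" by (simp add: N_def power_add mult_ac)
    also have "\<dots> \<le> C * (fact N * exp (1 + ?r) * ?e)"
      using C pow by (intro mult_left_mono mult_right_mono) auto
    also have "\<dots> \<le> C * (fact N * exp (1 + s / 2))"
      using C ex by (intro mult_left_mono) (auto simp: mult.assoc)
    finally show ?thesis .
  qed
  then show ?thesis using C(1) by (intro exI[of _ "C * (fact N * exp (1 + s / 2))"]) auto
qed

text \<open>Expanding the direction in the orthonormal basis reduces the whole derivative to finitely many
  directional derivatives, each of which lies in the class again.\<close>

lemma gaussian_polynomials_derivative_decay: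
  fixes h :: "'a::euclidean_space \<Rightarrow> real"
  assumes "s > 0" "h \<in> gaussian_polynomials s"
  shows "\<exists>D. \<exists>C\<ge>0. (\<forall>x. (h has_derivative D x) (at x)) \<and>
           (\<forall>x v. (1 + norm x) ^ k * \<bar>D x v\<bar> \<le> C * norm v)"
proof -
  obtain D where D: "\<And>x. (h has_derivative D x) (at x)" "\<And>v. (\<lambda>x. D x v) \<in> gaussian_polynomials s"
    using gaussian_polynomials_has_derivative[OF assms] by blast
  obtain C where C: "\<And>b. C b \<ge> 0" "\<And>b x. (1 + norm x) ^ k * \<bar>D x b\<bar> \<le> C b"
    using gaussian_polynomials_decay[OF assms(1) D(2)] by metis
  have "(1 + norm x) ^ k * \<bar>D x v\<bar> \<le> (\<Sum>b\<in>Basis. C b) * norm v" for x v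
  proof -
    have lin: "linear (D x)" using D(1) has_derivative_linear by blast
    have "D x v = D x (\<Sum>b\<in>Basis. (v \<bullet> b) *\<^sub>R b)" by (simp add: euclidean_representation)
    also have "\<dots> = (\<Sum>b\<in>Basis. (v \<bullet> b) * D x b)"
      by (simp add: linear_sum[OF lin] linear_cmul[OF lin])
    finally have "\<bar>D x v\<bar> \<le> (\<Sum>b\<in>Basis. \<bar>v \<bullet> b\<bar> * \<bar>D x b\<bar>)"
      by (metis (no_types, lifting) abs_mult sum.cong sum_abs)
    also have "\<dots> \<le> (\<Sum>b\<in>Basis. norm v * \<bar>D x b\<bar>)"
      by (intro sum_mono mult_right_mono) (auto simp: Basis_le_norm)
    finally have "(1 + norm x) ^ k * \<bar>D x v\<bar> \<le> (1 + norm x) ^ k * (\<Sum>b\<in>Basis. norm v * \<bar>D x b\<bar>)"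
      by (intro mult_left_mono) auto
    also have "\<dots> = (\<Sum>b\<in>Basis. norm v * ((1 + norm x) ^ k * \<bar>D x b\<bar>))"
      by (simp add: sum_distrib_left mult_ac)
    also have "\<dots> \<le> (\<Sum>b\<in>Basis. norm v * C b)"
      using C by (intro sum_mono mult_left_mono) auto
    finally show ?thesis by (simp add: sum_distrib_left mult.commute)
  qed
  then show ?thesis using D(1) C(1) by (metis sum_nonneg)
qed

text \<open>The mean value theorem on the segment from \<open>b - x\<close> to \<open>a - x\<close>: the decay of the derivative there
  compensates the weight, because \<open>\<bar>x\<bar>\<close> exceeds the norm of a point of the segment by at most
  \<open>\<bar>a\<bar> + \<bar>b\<bar>\<close>.\<close>

lemma gaussian_polynomials_weighted_lipschitz:
  fixes h :: "'a::euclidean_space \<Rightarrow> real"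
  assumes "s > 0" "h \<in> gaussian_polynomials s"
  shows "\<exists>C\<ge>0. \<forall>a b x. norm x ^ k * \<bar>h (a - x) - h (b - x)\<bar> \<le>
           C * (1 + norm a + norm b) ^ k * norm (a - b)"
proof -
  obtain D C where D: "\<And>x. (h has_derivative D x) (at x)"
    and C: "C \<ge> 0" "\<And>x v. (1 + norm x) ^ k * \<bar>D x v\<bar> \<le> C * norm v"
    using gaussian_polynomials_derivative_decay[OF assms, of k] by blast
  have "norm x ^ k * \<bar>h (a - x) - h (b - x)\<bar> \<le> C * (1 + norm a + norm b) ^ k * norm (a - b)" for a b x
  proof -
    define l where "l = (\<lambda>\<theta>::real. (b - x) + \<theta> *\<^sub>R (a - b))"
    have "((\<lambda>\<theta>. h (l \<theta>)) has_derivative (\<lambda>r. D (l \<theta>) (r *\<^sub>R (a - b)))) (at \<theta> within {0..1})" for \<theta>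
    proof (rule has_derivative_compose[where f = l and g = h])
      show "(l has_derivative (\<lambda>r. r *\<^sub>R (a - b))) (at \<theta> within {0..1})"
        unfolding l_def by (auto intro!: derivative_eq_intros)
      show "(h has_derivative D (l \<theta>)) (at (l \<theta>))" by (rule D)
    qed
    then obtain \<theta> where \<theta>: "\<theta> \<in> {0<..<1}" "h (l 1) - h (l 0) = D (l \<theta>) ((1 - 0) *\<^sub>R (a - b))"
      using mvt_simple[of 0 1 "\<lambda>\<theta>. h (l \<theta>)" "\<lambda>\<theta> r. D (l \<theta>) (r *\<^sub>R (a - b))"] by auto
    have eq: "h (a - x) - h (b - x) = D (l \<theta>) (a - b)" using \<theta>(2) by (simp add: l_def)
    have "x = ((1 - \<theta>) *\<^sub>R b + \<theta> *\<^sub>R a) - l \<theta>" by (simp add: l_def algebra_simps)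
    then have "norm x \<le> norm ((1 - \<theta>) *\<^sub>R b + \<theta> *\<^sub>R a) + norm (l \<theta>)"
      by (metis norm_triangle_ineq4)
    also have "norm ((1 - \<theta>) *\<^sub>R b + \<theta> *\<^sub>R a) \<le> norm b + norm a"
      using \<theta>(1) by (intro norm_triangle_mono) (auto simp: mult_left_le_one_le)
    finally have "norm x \<le> norm b + norm a + norm (l \<theta>)" by simp
    moreover have "0 \<le> norm (l \<theta>) * (norm a + norm b)" by simp
    moreover have "norm b + norm a + norm (l \<theta>) + norm (l \<theta>) * (norm a + norm b) + 1
        = (1 + norm (l \<theta>)) * (1 + norm a + norm b)"
      by (simp add: algebra_simps)
    ultimately have "norm x \<le> (1 + norm (l \<theta>)) * (1 + norm a + norm b)" by linarith
    then have "norm x ^ k \<le> (1 + norm (l \<theta>)) ^ k * (1 + norm a + norm b) ^ k"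
      by (metis norm_ge_zero power_mono power_mult_distrib)
    then have "norm x ^ k * \<bar>D (l \<theta>) (a - b)\<bar> \<le>
        ((1 + norm (l \<theta>)) ^ k * (1 + norm a + norm b) ^ k) * \<bar>D (l \<theta>) (a - b)\<bar>"
      by (intro mult_right_mono) auto
    also have "\<dots> = (1 + norm a + norm b) ^ k * ((1 + norm (l \<theta>)) ^ k * \<bar>D (l \<theta>) (a - b)\<bar>)"
      by simp
    also have "\<dots> \<le> (1 + norm a + norm b) ^ k * (C * norm (a - b))"
      by (intro mult_left_mono C) auto
    finally show ?thesis by (simp add: eq mult_ac)
  qed
  with C(1) show ?thesis by blast
qed

text \<open>The witness is independent of the translation \<open>a\<close>; this uniformity is what makes translation
  continuous in the Schwartz topology.\<close>

lemma iterated_partial_translate_gaussian: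
  fixes h :: "'a::euclidean_space \<Rightarrow> real"
  assumes "s > 0" "h \<in> gaussian_polynomials s"
  shows "\<exists>g\<in>gaussian_polynomials s. \<forall>a. iterated_partial vs (\<lambda>x. h (a - x)) = (\<lambda>x. g (a - x))"
proof (induction vs)
  case Nil
  then show ?case using assms by auto
next
  case (Cons v vs)
  then obtain g where g: "g \<in> gaussian_polynomials s"
    "\<And>a. iterated_partial vs (\<lambda>x. h (a - x)) = (\<lambda>x. g (a - x))" by blast
  obtain D where D: "\<And>x. (g has_derivative D x) (at x)" "\<And>v. (\<lambda>x. D x v) \<in> gaussian_polynomials s"
    using gaussian_polynomials_has_derivative[OF assms(1) g(1)] by blast
  have "((\<lambda>x. g (a - x)) has_derivative (\<lambda>v. D (a - x) (- v))) (at x)" for a x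
    by (rule has_derivative_compose[where f = "\<lambda>x. a - x" and g = g])
       (auto intro!: derivative_eq_intros D)
  note frechet_derivative_at[OF this, symmetric, simp]
  have "iterated_partial (v # vs) (\<lambda>x. h (a - x)) = (\<lambda>x. D (a - x) (- v))" for a
    by (simp add: g(2))
  with D(2)[of "- v"] show ?case by (intro bexI[of _ "\<lambda>x. D x (- v)"]) auto
qed

lemma translated_gaussian_schwartz:
  fixes h :: "'a::euclidean_space \<Rightarrow> real"
  assumes "s > 0" "h \<in> gaussian_polynomials s"
  shows "(\<lambda>x. h (a - x)) \<in> schwartz"
  unfolding schwartz_def
proof (intro CollectI ballI conjI allI)
  fix vs :: "'a list" and k :: nat
  obtain g where g: "g \<in> gaussian_polynomials s"
    "\<And>a. iterated_partial vs (\<lambda>x. h (a - x)) = (\<lambda>x. g (a - x))"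
    using iterated_partial_translate_gaussian[OF assms] by blast
  obtain D where D: "\<And>x. (g has_derivative D x) (at x)"
    using gaussian_polynomials_has_derivative[OF assms(1) g(1)] by blast
  have "((\<lambda>x. g (a - x)) has_derivative (\<lambda>v. D (a - x) (- v))) (at x)" for x
    by (rule has_derivative_compose[where f = "\<lambda>x. a - x" and g = g])
       (auto intro!: derivative_eq_intros D)
  then show "iterated_partial vs (\<lambda>x. h (a - x)) differentiable_on UNIV"
    unfolding g(2) differentiable_on_def differentiable_def by blast
  obtain C where C: "C \<ge> 0" "\<And>x. (1 + norm x) ^ k * \<bar>g x\<bar> \<le> C"
    using gaussian_polynomials_decay[OF assms(1) g(1)] by blast
  have "norm x ^ k * \<bar>g (a - x)\<bar> \<le> (1 + norm a) ^ k * C" for x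
  proof -
    have "norm x \<le> norm a + norm (a - x)"
      using norm_triangle_ineq4[of a "a - x"] by simp
    also have "\<dots> \<le> (1 + norm a) * (1 + norm (a - x))" by (simp add: algebra_simps)
    finally have "norm x ^ k \<le> (1 + norm a) ^ k * (1 + norm (a - x)) ^ k"
      by (metis norm_ge_zero power_mono power_mult_distrib)
    then have "norm x ^ k * \<bar>g (a - x)\<bar> \<le> ((1 + norm a) ^ k * (1 + norm (a - x)) ^ k) * \<bar>g (a - x)\<bar>"
      by (intro mult_right_mono) auto
    also have "\<dots> \<le> (1 + norm a) ^ k * C"
      unfolding mult.assoc by (intro mult_left_mono C) auto
    finally show ?thesis .
  qed
  then show "bounded (range (\<lambda>x. norm x ^ k * iterated_partial vs (\<lambda>x. h (a - x)) x))"
    unfolding g(2) bounded_iff by (auto simp: abs_mult)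
qed

lemma translated_gaussian_schwartz_tendsto:
  fixes h :: "'a::euclidean_space \<Rightarrow> real"
  assumes "s > 0" "h \<in> gaussian_polynomials s" "a \<longlonglongrightarrow> b"
  shows "schwartz_tendsto (\<lambda>n x. h (a n - x)) (\<lambda>x. h (b - x))"
  unfolding schwartz_tendsto_def
proof (intro ballI allI)
  fix vs :: "'a list" and k :: nat
  obtain g where g: "g \<in> gaussian_polynomials s"
    "\<And>a. iterated_partial vs (\<lambda>x. h (a - x)) = (\<lambda>x. g (a - x))"
    using iterated_partial_translate_gaussian[OF assms(1,2)] by blast
  obtain C where C: "\<And>a b x. norm x ^ k * \<bar>g (a - x) - g (b - x)\<bar> \<le>
           C * (1 + norm a + norm b) ^ k * norm (a - b)"
    using gaussian_polynomials_weighted_lipschitz[OF assms(1) g(1), of k] by blast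
  have "(\<lambda>n. C * (1 + norm (a n) + norm b) ^ k * norm (a n - b)) \<longlonglongrightarrow>
      C * (1 + norm b + norm b) ^ k * norm (b - b)"
    by (intro tendsto_intros assms(3))
  then have lim: "(\<lambda>n. C * (1 + norm (a n) + norm b) ^ k * norm (a n - b)) \<longlonglongrightarrow> 0" by simp
  show "uniform_limit UNIV (\<lambda>n x. norm x ^ k * iterated_partial vs (\<lambda>x. h (a n - x)) x)
       (\<lambda>x. norm x ^ k * iterated_partial vs (\<lambda>x. h (b - x)) x) sequentially"
    unfolding g(2)
  proof (rule uniform_limitI)
    fix e :: real assume "e > 0"
    with lim have "\<forall>\<^sub>F n in sequentially. C * (1 + norm (a n) + norm b) ^ k * norm (a n - b) < e"
      by (rule order_tendstoD)
    then show "\<forall>\<^sub>F n in sequentially. \<forall>x\<in>UNIV.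
        dist (norm x ^ k * g (a n - x)) (norm x ^ k * g (b - x)) < e"
    proof eventually_elim
      case (elim n)
      show ?case
      proof
        fix x
        have "dist (norm x ^ k * g (a n - x)) (norm x ^ k * g (b - x)) =
            norm x ^ k * \<bar>g (a n - x) - g (b - x)\<bar>"
          by (simp add: dist_real_def right_diff_distrib[symmetric] abs_mult)
        also have "\<dots> < e" using C[of x "a n" b] elim by (rule le_less_trans)
        finally show "dist (norm x ^ k * g (a n - x)) (norm x ^ k * g (b - x)) < e" .
      qed
    qed
  qed
qed

lemma iterated_partial_add:
  fixes \<phi> \<psi> :: "'a::euclidean_space \<Rightarrow> real"
  assumes "\<phi> \<in> schwartz" "\<psi> \<in> schwartz" "vs \<in> lists Basis"
  shows "iterated_partial vs (\<lambda>x. \<phi> x + \<psi> x) = (\<lambda>x. iterated_partial vs \<phi> x + iterated_partial vs \<psi> x)"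
  using assms(3)
proof induction
  case Nil
  show ?case by simp
next
  case (Cons v vs)
  have "iterated_partial vs \<phi> differentiable at x" "iterated_partial vs \<psi> differentiable at x" for x
    using assms Cons.hyps by (auto simp: schwartz_def differentiable_on_def)
  then have "((\<lambda>x. iterated_partial vs \<phi> x + iterated_partial vs \<psi> x) has_derivative
      (\<lambda>v. frechet_derivative (iterated_partial vs \<phi>) (at x) v +
           frechet_derivative (iterated_partial vs \<psi>) (at x) v)) (at x)" for x
    by (intro has_derivative_add) (auto simp: frechet_derivative_works[symmetric])
  note frechet_derivative_at[OF this, symmetric, simp]
  show ?case by (simp add: Cons.IH)
qed

lemma schwartz_add:
  fixes \<phi> \<psi> :: "'a::euclidean_space \<Rightarrow> real"
  assumes "\<phi> \<in> schwartz" "\<psi> \<in> schwartz"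
  shows "(\<lambda>x. \<phi> x + \<psi> x) \<in> schwartz"
  unfolding schwartz_def
proof (intro CollectI ballI conjI allI)
  fix vs :: "'a list" and k :: nat
  assume vs: "vs \<in> lists Basis"
  show "iterated_partial vs (\<lambda>x. \<phi> x + \<psi> x) differentiable_on UNIV"
    unfolding iterated_partial_add[OF assms vs]
    using assms vs by (intro differentiable_on_add) (auto simp: schwartz_def)
  have "bounded (range (\<lambda>x. norm x ^ k * iterated_partial vs \<phi> x))"
    "bounded (range (\<lambda>x. norm x ^ k * iterated_partial vs \<psi> x))"
    using assms vs by (auto simp: schwartz_def)
  then show "bounded (range (\<lambda>x. norm x ^ k * iterated_partial vs (\<lambda>x. \<phi> x + \<psi> x) x))"
    unfolding iterated_partial_add[OF assms vs] distrib_left by (rule bounded_plus_comp)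
qed


section \<open>Heat kernels and the smoothed noise\<close>

lemma heat_kernel_pos: "s > 0 \<Longrightarrow> heat_kernel s x > 0"
  by (simp add: heat_kernel_def)

lemma heat_kernel_minus: "heat_kernel s (- x) = heat_kernel s x"
  by (simp add: heat_kernel_def)

lemma continuous_on_heat_kernel [continuous_intros]:
  "continuous_on A f \<Longrightarrow> continuous_on A (\<lambda>x. heat_kernel s (f x))"
  unfolding heat_kernel_def divide_inverse by (intro continuous_intros)

lemma borel_measurable_heat_kernel [measurable]: "heat_kernel s \<in> borel_measurable borel"
  by (intro borel_measurable_continuous_onI continuous_intros)

lemma heat_kernel_gaussian_polynomial: "heat_kernel s \<in> gaussian_polynomials s"
  unfolding gaussian_polynomials_def
  by (intro CollectI exI[of _ "\<lambda>x. 1 / (2 * pi * s)"])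
     (auto simp: heat_kernel_def fun_eq_iff intro: real_polynomial_function.intros(2))

text \<open>Reduces planar convolutions to convolutions of one-dimensional normal densities.\<close>

lemma heat_kernel_eq_normal_density:
  assumes "s > 0"
  shows "heat_kernel s (a, b) = normal_density 0 (sqrt s) a * normal_density 0 (sqrt s) b"
proof -
  have "normal_density 0 (sqrt s) a * normal_density 0 (sqrt s) b =
     1 / (sqrt (2 * pi * s) * sqrt (2 * pi * s)) * (exp (- a\<^sup>2 / (2 * s)) * exp (- b\<^sup>2 / (2 * s)))"
    using assms by (simp add: normal_density_def)
  also have "\<dots> = 1 / (2 * pi * s) * exp (- (a\<^sup>2 + b\<^sup>2) / (2 * s))"
    using assms by (simp add: exp_add[symmetric] add_divide_distrib diff_divide_distrib)
  finally show ?thesis by (simp add: heat_kernel_def norm_Pair)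
qed

lemma nn_integral_plane_product:
  fixes f g :: "real \<Rightarrow> real"
  assumes [measurable]: "f \<in> borel_measurable borel" "g \<in> borel_measurable borel"
    and "\<And>x. f x \<ge> 0" "\<And>x. g x \<ge> 0"
  shows "(\<integral>\<^sup>+z. ennreal (f (fst z) * g (snd z)) \<partial>lborel) =
    (\<integral>\<^sup>+x. ennreal (f x) \<partial>lborel) * (\<integral>\<^sup>+y. ennreal (g y) \<partial>lborel)"
proof -
  have "(\<integral>\<^sup>+z. ennreal (f (fst z) * g (snd z)) \<partial>lborel) =
      (\<integral>\<^sup>+z. ennreal (f (fst z) * g (snd z)) \<partial>(lborel \<Otimes>\<^sub>M lborel))"
    by (simp add: lborel_prod)
  also have "\<dots> = (\<integral>\<^sup>+x. \<integral>\<^sup>+y. ennreal (f x * g y) \<partial>lborel \<partial>lborel)"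
    by (subst lborel.nn_integral_fst[symmetric]) auto
  also have "\<dots> = (\<integral>\<^sup>+x. ennreal (f x) * (\<integral>\<^sup>+y. ennreal (g y) \<partial>lborel) \<partial>lborel)"
    using assms by (simp add: ennreal_mult nn_integral_cmult)
  also have "\<dots> = (\<integral>\<^sup>+x. ennreal (f x) \<partial>lborel) * (\<integral>\<^sup>+y. ennreal (g y) \<partial>lborel)"
    by (simp add: nn_integral_multc)
  finally show ?thesis .
qed

lemma nn_integral_plane_translate:
  fixes f :: "plane \<Rightarrow> ennreal"
  assumes [measurable]: "f \<in> borel_measurable borel"
  shows "(\<integral>\<^sup>+z. f (c + z) \<partial>lborel) = (\<integral>\<^sup>+z. f z \<partial>lborel)"
proof -
  have "(\<integral>\<^sup>+z. f z \<partial>lborel) = (\<integral>\<^sup>+z. f z \<partial>distr lborel borel ((+) c))"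
    by (simp add: lborel_distr_plus)
  then show ?thesis by (simp add: nn_integral_distr)
qed

text \<open>Since the kernel is even, this is the convolution of two heat kernels.  Written symmetrically, it
  is an inner product of translated kernels, that is, a covariance of the smoothed noise.\<close>

lemma heat_kernel_semigroup:
  assumes "s > 0" "t > 0"
  shows "has_bochner_integral lborel (\<lambda>z. heat_kernel s (a - z) * heat_kernel t (b - z))
           (heat_kernel (s + t) (a - b))"
proof (rule has_bochner_integral_nn_integral)
  define f where "f = (\<lambda>c y. normal_density 0 (sqrt s) (c - y) * normal_density 0 (sqrt t) y)"
  have conv: "(\<integral>\<^sup>+y. ennreal (f c y) \<partial>lborel) = normal_density 0 (sqrt (s + t)) c" for c
    using fun_cong[OF conv_normal_density_zero_mean[of "sqrt s" "sqrt t"], of c] assms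
    by (simp add: f_def)
  define G where "G = (\<lambda>w. f (fst (a - b)) (fst w) * f (snd (a - b)) (snd w))"
  have [measurable]: "G \<in> borel_measurable borel" unfolding G_def f_def borel_prod[symmetric] by measurable
  have "heat_kernel s (a - z) * heat_kernel t (b - z) = G (- b + z)" for z
    using assms heat_kernel_minus[of t "b - z"]
    by (cases a; cases b; cases z) (simp add: f_def G_def heat_kernel_eq_normal_density)
  then have "(\<integral>\<^sup>+z. ennreal (heat_kernel s (a - z) * heat_kernel t (b - z)) \<partial>lborel) =
      (\<integral>\<^sup>+w. ennreal (G w) \<partial>lborel)"
    using nn_integral_plane_translate[of "\<lambda>w. ennreal (G w)" "- b"] by simp
  also have "\<dots> = ennreal (normal_density 0 (sqrt (s + t)) (fst (a - b))) *
      ennreal (normal_density 0 (sqrt (s + t)) (snd (a - b)))"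
    unfolding G_def by (subst nn_integral_plane_product) (auto simp: conv, auto simp: f_def)
  also have "\<dots> = ennreal (heat_kernel (s + t) (a - b))"
    using assms by (cases a; cases b) (simp add: heat_kernel_eq_normal_density ennreal_mult)
  finally show "(\<integral>\<^sup>+z. ennreal (heat_kernel s (a - z) * heat_kernel t (b - z)) \<partial>lborel) =
      ennreal (heat_kernel (s + t) (a - b))" .
qed (use assms in \<open>auto intro!: mult_nonneg_nonneg less_imp_le[OF heat_kernel_pos]\<close>)

lemma nn_integral_heat_kernel:
  assumes "s > 0"
  shows "(\<integral>\<^sup>+z. ennreal (heat_kernel s (a - z)) \<partial>lborel) = 1"
proof -
  have nd: "(\<integral>\<^sup>+y. ennreal (normal_density 0 (sqrt s) y) \<partial>lborel) = 1"
    using assms by (subst nn_integral_eq_integral) auto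
  define G where "G = (\<lambda>w. normal_density 0 (sqrt s) (fst w) * normal_density 0 (sqrt s) (snd w))"
  have [measurable]: "G \<in> borel_measurable borel" unfolding G_def borel_prod[symmetric] by measurable
  have "heat_kernel s (a - z) = G (- a + z)" for z
    using assms heat_kernel_minus[of s "a - z"]
    by (cases a; cases z) (simp add: G_def heat_kernel_eq_normal_density)
  then have "(\<integral>\<^sup>+z. ennreal (heat_kernel s (a - z)) \<partial>lborel) =
      (\<integral>\<^sup>+w. ennreal (G w) \<partial>lborel)"
    using nn_integral_plane_translate[of "\<lambda>w. ennreal (G w)" "- a"] by simp
  also have "\<dots> = 1"
    unfolding G_def by (subst nn_integral_plane_product) (auto simp: nd)
  finally show ?thesis .
qed

lemma centred_normal_second_moment:
  assumes "\<sigma> > 0" "distributed M lborel X (normal_density 0 \<sigma>)"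
  shows "has_bochner_integral M (\<lambda>\<omega>. (X \<omega>)\<^sup>2) (\<sigma>\<^sup>2)"
proof -
  have m: "has_bochner_integral lborel (\<lambda>x. normal_density 0 \<sigma> x * x\<^sup>2) (\<sigma>\<^sup>2)"
    using normal_moment_even[OF assms(1), of 0 1] by (simp add: power2_eq_square)
  show ?thesis
    unfolding has_bochner_integral_iff
    using distributed_integrable[OF assms(2), of "\<lambda>x. x\<^sup>2"]
      distributed_integral[OF assms(2), of "\<lambda>x. x\<^sup>2"] m
    by (simp add: has_bochner_integral_iff)
qed

text \<open>The assumption contains \<open>prob_space M\<close>; naming the probability space as a parent locale makes its
  theory available inside.\<close>

locale white_noise_on_plane = prob_space M
  for M :: "'w measure" +
  fixes \<eta> :: "'w \<Rightarrow> (plane \<Rightarrow> real) \<Rightarrow> real"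
  assumes noise: "white_noise M \<eta>"
begin

text \<open>The mollified noise and its heat flow are both of this form, with \<open>s = \<epsilon>\<^sup>2\<close> and \<open>s = t + \<epsilon>\<^sup>2\<close>.\<close>

definition smoothed :: "real \<Rightarrow> plane \<Rightarrow> 'w \<Rightarrow> real" where
  "smoothed s a \<omega> = \<eta> \<omega> (\<lambda>z. heat_kernel s (a - z))"

lemma translated_heat_kernel_schwartz: "s > 0 \<Longrightarrow> (\<lambda>z. heat_kernel s (a - z)) \<in> schwartz"
  by (rule translated_gaussian_schwartz[OF _ heat_kernel_gaussian_polynomial])

lemma heat_kernel_square_integral:
  assumes "s > 0"
  shows "(\<integral>z. (heat_kernel s (a - z))\<^sup>2 \<partial>lborel) = heat_kernel (2 * s) 0"
  using heat_kernel_semigroup[OF assms assms, of a a]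
  by (simp add: has_bochner_integral_iff power2_eq_square)

lemma smoothed_distributed:
  assumes "s > 0"
  shows "distributed M lborel (smoothed s a) (normal_density 0 (sqrt (heat_kernel (2 * s) 0)))"
proof -
  have "(\<lambda>z. heat_kernel s (a - z)) \<noteq> (\<lambda>z. 0)"
    using heat_kernel_pos[OF assms] by (metis less_irrefl)
  then show ?thesis
    using noise translated_heat_kernel_schwartz[OF assms]
    unfolding white_noise_def smoothed_def heat_kernel_square_integral[OF assms, of a, symmetric]
    by blast
qed

lemma borel_measurable_smoothed: "s > 0 \<Longrightarrow> smoothed s a \<in> borel_measurable M"
  using distributed_measurable[OF smoothed_distributed] by simp

text \<open>Polarization: the sum of two heat kernels is a nonzero test function, so the second moment of the
  sum of the two pairings is known as well.\<close>

lemma smoothed_covariance: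
  assumes "s > 0" "t > 0"
  shows "has_bochner_integral M (\<lambda>\<omega>. smoothed s a \<omega> * smoothed t b \<omega>) (heat_kernel (s + t) (a - b))"
proof -
  define \<phi> where "\<phi> = (\<lambda>z. heat_kernel s (a - z))"
  define \<psi> where "\<psi> = (\<lambda>z. heat_kernel t (b - z))"
  have sch: "\<phi> \<in> schwartz" "\<psi> \<in> schwartz" "(\<lambda>z. \<phi> z + \<psi> z) \<in> schwartz"
    unfolding \<phi>_def \<psi>_def using assms by (auto intro!: schwartz_add translated_heat_kernel_schwartz)
  have lin: "\<eta> \<omega> (\<lambda>z. \<phi> z + \<psi> z) = smoothed s a \<omega> + smoothed t b \<omega>" if "\<omega> \<in> space M" for \<omega>
  proof -
    have "tempered_distribution (\<eta> \<omega>)" using noise that by (auto simp: white_noise_def)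
    then have "\<eta> \<omega> (\<lambda>z. 1 * \<phi> z + 1 * \<psi> z) = 1 * \<eta> \<omega> \<phi> + 1 * \<eta> \<omega> \<psi>"
      using sch unfolding tempered_distribution_def by blast
    then show ?thesis by (simp add: smoothed_def \<phi>_def \<psi>_def)
  qed
  define A where "A = heat_kernel (2 * s) 0 + 2 * heat_kernel (s + t) (a - b) + heat_kernel (2 * t) 0"
  have A_pos: "A > 0" using assms by (simp add: A_def heat_kernel_pos add_pos_pos)
  have "has_bochner_integral lborel
      (\<lambda>z. \<phi> z * \<phi> z + 2 * (\<phi> z * \<psi> z) + \<psi> z * \<psi> z) A"
    using heat_kernel_semigroup[OF assms(1) assms(1), of a a] heat_kernel_semigroup[OF assms, of a b]
      heat_kernel_semigroup[OF assms(2) assms(2), of b b]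
    unfolding A_def \<phi>_def \<psi>_def
    by (intro has_bochner_integral_add has_bochner_integral_mult_right) auto
  then have int: "(\<integral>z. (\<phi> z + \<psi> z)\<^sup>2 \<partial>lborel) = A"
    by (simp add: has_bochner_integral_iff power2_eq_square algebra_simps)
  have "(\<lambda>z. \<phi> z + \<psi> z) 0 \<noteq> 0"
    using heat_kernel_pos[OF assms(1), of "a - 0"] heat_kernel_pos[OF assms(2), of "b - 0"]
    unfolding \<phi>_def \<psi>_def by linarith
  then have "(\<lambda>z. \<phi> z + \<psi> z) \<noteq> (\<lambda>z. 0)" by metis
  then have "distributed M lborel (\<lambda>\<omega>. \<eta> \<omega> (\<lambda>z. \<phi> z + \<psi> z)) (normal_density 0 (sqrt A))"
    using noise sch(3) unfolding white_noise_def int[symmetric] by blast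
  then have "has_bochner_integral M (\<lambda>\<omega>. (\<eta> \<omega> (\<lambda>z. \<phi> z + \<psi> z))\<^sup>2) ((sqrt A)\<^sup>2)"
    using A_pos by (intro centred_normal_second_moment) auto
  then have sq: "has_bochner_integral M (\<lambda>\<omega>. (smoothed s a \<omega> + smoothed t b \<omega>)\<^sup>2) A"
    using A_pos lin by (simp cong: has_bochner_integral_cong)
  have "has_bochner_integral M (\<lambda>\<omega>. 1/2 * ((smoothed s a \<omega> + smoothed t b \<omega>)\<^sup>2 -
      (smoothed s a \<omega>)\<^sup>2 - (smoothed t b \<omega>)\<^sup>2))
      (1/2 * (A - (sqrt (heat_kernel (2 * s) 0))\<^sup>2 - (sqrt (heat_kernel (2 * t) 0))\<^sup>2))"
    using assms
    by (intro has_bochner_integral_mult_right has_bochner_integral_diff sq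
        centred_normal_second_moment smoothed_distributed) (auto simp: heat_kernel_pos)
  moreover have "(sqrt (heat_kernel (2 * s) 0))\<^sup>2 = heat_kernel (2 * s) 0"
    "(sqrt (heat_kernel (2 * t) 0))\<^sup>2 = heat_kernel (2 * t) 0"
    using assms by (auto intro!: real_sqrt_pow2 less_imp_le heat_kernel_pos)
  ultimately show ?thesis
    by (simp add: A_def power2_eq_square algebra_simps)
qed

lemma smoothed_continuous:
  assumes "s > 0" "\<omega> \<in> space M" "a \<longlonglongrightarrow> b"
  shows "(\<lambda>n. smoothed s (a n) \<omega>) \<longlonglongrightarrow> smoothed s b \<omega>"
proof -
  have "tempered_distribution (\<eta> \<omega>)" using noise assms(2) by (auto simp: white_noise_def)
  then show ?thesis
    unfolding smoothed_def tempered_distribution_def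
    using translated_heat_kernel_schwartz[OF assms(1)]
      translated_gaussian_schwartz_tendsto[OF assms(1) heat_kernel_gaussian_polynomial assms(3)]
    by simp
qed

text \<open>For fixed \<open>\<omega>\<close> the field is continuous in \<open>y\<close>, since \<open>\<eta> \<omega>\<close> is a tempered distribution, and for fixed
  \<open>y\<close> it is measurable in \<open>\<omega>\<close>.  Such a function is the pointwise limit of its evaluations at the
  grid points below \<open>y\<close>, of which there are only countably many.\<close>

lemma smoothed_jointly_measurable:
  assumes "s > 0"
  shows "(\<lambda>(\<omega>, y). smoothed s y \<omega>) \<in> borel_measurable (M \<Otimes>\<^sub>M lborel)"
proof -
  \<comment> \<open>Evaluation takes place at the lower left corners of the cells of a grid of mesh \<open>1 / (n + 1)\<close>.\<close>
  define r where "r = (\<lambda>n (i::int, j::int). (of_int i / real (Suc n), of_int j / real (Suc n)))"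
  define g where "g = (\<lambda>n (y::plane). (\<lfloor>fst y * real (Suc n)\<rfloor>, \<lfloor>snd y * real (Suc n)\<rfloor>))"
  have floor_lim: "(\<lambda>n. of_int \<lfloor>u * real (Suc n)\<rfloor> / real (Suc n)) \<longlonglongrightarrow> u" for u :: real
  proof (rule tendsto_sandwich)
    show "\<forall>\<^sub>F n in sequentially. u - 1 / real (Suc n) \<le> of_int \<lfloor>u * real (Suc n)\<rfloor> / real (Suc n)"
    proof (intro always_eventually allI)
      fix n
      have "u * real (Suc n) - 1 \<le> of_int \<lfloor>u * real (Suc n)\<rfloor>" by linarith
      then have "(u * real (Suc n) - 1) / real (Suc n) \<le> of_int \<lfloor>u * real (Suc n)\<rfloor> / real (Suc n)"
        by (rule divide_right_mono) simp
      then show "u - 1 / real (Suc n) \<le> of_int \<lfloor>u * real (Suc n)\<rfloor> / real (Suc n)"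
        by (simp add: diff_divide_distrib)
    qed
    show "\<forall>\<^sub>F n in sequentially. of_int \<lfloor>u * real (Suc n)\<rfloor> / real (Suc n) \<le> u"
      by (intro always_eventually allI) (simp add: divide_le_eq)
    show "(\<lambda>n. u - 1 / real (Suc n)) \<longlonglongrightarrow> u"
      using tendsto_diff[OF tendsto_const LIMSEQ_Suc[OF lim_1_over_n], of u] by simp
  qed simp
  have lim: "(\<lambda>n. r n (g n y)) \<longlonglongrightarrow> y" for y
    using tendsto_Pair[OF floor_lim[of "fst y"] floor_lim[of "snd y"]] by (simp add: r_def g_def)
  show ?thesis
  proof (rule borel_measurable_LIMSEQ_metric)
    fix n
    have [measurable]: "g n \<in> borel \<rightarrow>\<^sub>M count_space UNIV"
    proof -
      have "(\<lambda>y::plane. \<lfloor>fst y * real (Suc n)\<rfloor>) \<in> borel \<rightarrow>\<^sub>M count_space UNIV"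
        "(\<lambda>y::plane. \<lfloor>snd y * real (Suc n)\<rfloor>) \<in> borel \<rightarrow>\<^sub>M count_space UNIV"
        by (intro measurable_compose[OF _ measurable_real_floor] borel_measurable_times
            borel_measurable_continuous_onI continuous_intros)+
      then have "g n \<in> borel \<rightarrow>\<^sub>M count_space UNIV \<Otimes>\<^sub>M count_space UNIV"
        unfolding g_def by (rule measurable_Pair)
      then show ?thesis by (simp add: pair_measure_countable)
    qed
    have "(\<lambda>p. (\<lambda>i p. smoothed s (r n i) (fst p)) (g n (snd p)) p) \<in> borel_measurable (M \<Otimes>\<^sub>M lborel)"
    proof (rule measurable_compose_countable)
      show "(\<lambda>p. smoothed s (r n i) (fst p)) \<in> borel_measurable (M \<Otimes>\<^sub>M lborel)" for i
        using borel_measurable_smoothed[OF assms] by measurable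
    qed measurable
    then show "(\<lambda>(\<omega>, y). smoothed s (r n (g n y)) \<omega>) \<in> borel_measurable (M \<Otimes>\<^sub>M lborel)"
      by (simp add: case_prod_beta)
  next
    fix p assume "p \<in> space (M \<Otimes>\<^sub>M (lborel :: plane measure))"
    then show "(\<lambda>n. case p of (\<omega>, y) \<Rightarrow> smoothed s (r n (g n y)) \<omega>) \<longlonglongrightarrow>
        (case p of (\<omega>, y) \<Rightarrow> smoothed s y \<omega>)"
      using smoothed_continuous[OF assms _ lim] by (auto simp: space_pair_measure)
  qed
qed

end


section \<open>Heat flow of the mollified noise\<close>

lemma integrable_mult_of_squares:
  fixes f g :: "'a \<Rightarrow> real"
  assumes [measurable]: "f \<in> borel_measurable M" "g \<in> borel_measurable M"
    and "integrable M (\<lambda>x. (f x)\<^sup>2)" "integrable M (\<lambda>x. (g x)\<^sup>2)"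
  shows "integrable M (\<lambda>x. f x * g x)"
proof (rule Bochner_Integration.integrable_bound)
  show "integrable M (\<lambda>x. (f x)\<^sup>2 + (g x)\<^sup>2)" using assms by auto
  have "\<bar>a * b\<bar> \<le> a\<^sup>2 + b\<^sup>2" for a b :: real
    using zero_le_power2[of "a + b"] zero_le_power2[of "a - b"] sum_power2_ge_zero[of a b]
    unfolding power2_sum power2_diff by linarith
  then show "AE x in M. norm (f x * g x) \<le> norm ((f x)\<^sup>2 + (g x)\<^sup>2)" by simp
qed measurable

text \<open>Let \<open>Z\<close> be the average of \<open>X\<close> over \<open>y\<close>.  The covariance hypotheses make \<open>Z - Y\<close> orthogonal to every
  \<open>X y\<close> and to \<open>Y\<close>.  Being orthogonal to every \<open>X y\<close>, it is by Fubini's theorem also orthogonal to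
  their average \<open>Z\<close>, hence to \<open>Z - Y\<close> itself.\<close>

lemma random_average_eq_projection:
  fixes X :: "'a \<Rightarrow> 'b \<Rightarrow> real" and Y :: "'a \<Rightarrow> real"
  assumes M: "prob_space M" and N: "prob_space N"
    and X [measurable]: "(\<lambda>(\<omega>, y). X \<omega> y) \<in> borel_measurable (M \<Otimes>\<^sub>M N)"
    and Y [measurable]: "Y \<in> borel_measurable M"
    and X2: "\<And>y. y \<in> space N \<Longrightarrow> has_bochner_integral M (\<lambda>\<omega>. (X \<omega> y)\<^sup>2) c"
    and Y2: "integrable M (\<lambda>\<omega>. (Y \<omega>)\<^sup>2)"
    and cov_X: "\<And>z. z \<in> space N \<Longrightarrow> (\<integral>y. (\<integral>\<omega>. X \<omega> y * X \<omega> z \<partial>M) \<partial>N) = (\<integral>\<omega>. Y \<omega> * X \<omega> z \<partial>M)"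
    and cov_Y: "(\<integral>y. (\<integral>\<omega>. X \<omega> y * Y \<omega> \<partial>M) \<partial>N) = (\<integral>\<omega>. (Y \<omega>)\<^sup>2 \<partial>M)"
  shows "AE \<omega> in M. (\<integral>y. X \<omega> y \<partial>N) = Y \<omega>"
proof -
  interpret M: prob_space M by (rule M)
  interpret N: prob_space N by (rule N)
  interpret P: pair_sigma_finite M N ..
  \<comment> \<open>The second moments are known for fixed \<open>y\<close>, so square integrability on the product is first
    obtained with the order of the factors reversed.\<close>
  interpret Q: pair_sigma_finite N M ..
  have Xy: "(\<lambda>\<omega>. X \<omega> y) \<in> borel_measurable M" if "y \<in> space N" for y
    using measurable_compose[OF measurable_Pair2'[OF that] X] by simp
  have Xw: "X \<omega> \<in> borel_measurable N" if "\<omega> \<in> space M" for \<omega>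
    using measurable_compose[OF measurable_Pair1'[OF that] X] by simp
  define Z where "Z = (\<lambda>\<omega>. \<integral>y. X \<omega> y \<partial>N)"
  have Z [measurable]: "Z \<in> borel_measurable M" unfolding Z_def by measurable
  have int_X2: "integrable (M \<Otimes>\<^sub>M N) (\<lambda>(\<omega>, y). (X \<omega> y)\<^sup>2)"
  proof -
    have "integrable (N \<Otimes>\<^sub>M M) (\<lambda>(y, \<omega>). (X \<omega> y)\<^sup>2)"
    proof (rule Q.Fubini_integrable)
      have "integrable N (\<lambda>y. \<integral>\<omega>. norm (case (y, \<omega>) of (y, \<omega>) \<Rightarrow> (X \<omega> y)\<^sup>2) \<partial>M) \<longleftrightarrow>
          integrable N (\<lambda>y. c)"
        using X2 by (intro Bochner_Integration.integrable_cong) (auto simp: has_bochner_integral_iff)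
      then show "integrable N (\<lambda>y. \<integral>\<omega>. norm (case (y, \<omega>) of (y, \<omega>) \<Rightarrow> (X \<omega> y)\<^sup>2) \<partial>M)" by simp
      show "AE y in N. integrable M (\<lambda>\<omega>. case (y, \<omega>) of (y, \<omega>) \<Rightarrow> (X \<omega> y)\<^sup>2)"
        using X2 by (auto simp: has_bochner_integral_iff)
    qed measurable
    from Q.integrable_product_swap[OF this] show ?thesis by simp
  qed
  have fubini: "integrable M (\<lambda>\<omega>. Z \<omega> * V \<omega>) \<and>
      (\<integral>\<omega>. Z \<omega> * V \<omega> \<partial>M) = (\<integral>y. (\<integral>\<omega>. X \<omega> y * V \<omega> \<partial>M) \<partial>N)"
    if V [measurable]: "V \<in> borel_measurable M" and V2: "integrable M (\<lambda>\<omega>. (V \<omega>)\<^sup>2)" for V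
  proof -
    have "integrable (M \<Otimes>\<^sub>M N) (\<lambda>(\<omega>, y). (V \<omega>)\<^sup>2)"
      by (rule P.Fubini_integrable) (use V2 N.prob_space in \<open>auto\<close>)
    then have "integrable (M \<Otimes>\<^sub>M N) (\<lambda>p. X (fst p) (snd p) * V (fst p))"
      using int_X2 by (intro integrable_mult_of_squares) (auto simp: case_prod_unfold)
    then have int: "integrable (M \<Otimes>\<^sub>M N) (\<lambda>(\<omega>, y). X \<omega> y * V \<omega>)" by (simp add: case_prod_unfold)
    show ?thesis
      using P.integrable_fst[OF int] P.Fubini_integral[OF int] by (simp add: Z_def)
  qed
  have Z2: "integrable M (\<lambda>\<omega>. (Z \<omega>)\<^sup>2)"
  proof (rule Bochner_Integration.integrable_bound)
    show "integrable M (\<lambda>\<omega>. \<integral>y. (X \<omega> y)\<^sup>2 \<partial>N)" by (rule P.integrable_fst[OF int_X2])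
    show "AE \<omega> in M. norm ((Z \<omega>)\<^sup>2) \<le> norm (\<integral>y. (X \<omega> y)\<^sup>2 \<partial>N)"
      using P.AE_integrable_fst[OF int_X2] AE_space[of M]
    proof eventually_elim
      case (elim \<omega>)
      note int_sq = elim(1)
      have int: "integrable N (X \<omega>)"
        by (rule N.square_integrable_imp_integrable[OF Xw[OF elim(2)] int_sq])
      have "0 \<le> (\<integral>y. (X \<omega> y - Z \<omega>)\<^sup>2 \<partial>N)" by (rule integral_nonneg_AE) simp
      also have "\<dots> = (\<integral>y. (X \<omega> y)\<^sup>2 \<partial>N) - (Z \<omega>)\<^sup>2"
        unfolding Z_def by (rule N.variance_eq[OF int int_sq])
      finally have "(Z \<omega>)\<^sup>2 \<le> (\<integral>y. (X \<omega> y)\<^sup>2 \<partial>N)" by simp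
      then show ?case by simp
    qed
  qed measurable
  define D where "D = (\<lambda>\<omega>. Z \<omega> - Y \<omega>)"
  have D [measurable]: "D \<in> borel_measurable M" unfolding D_def by measurable
  have int_ZY: "integrable M (\<lambda>\<omega>. Z \<omega> * Y \<omega>)" using fubini[OF Y Y2] by simp
  have D2: "integrable M (\<lambda>\<omega>. (D \<omega>)\<^sup>2)"
  proof -
    have "integrable M (\<lambda>\<omega>. (Z \<omega>)\<^sup>2 - 2 * (Z \<omega> * Y \<omega>) + (Y \<omega>)\<^sup>2)" using Z2 Y2 int_ZY by auto
    moreover have "(\<lambda>\<omega>. (Z \<omega>)\<^sup>2 - 2 * (Z \<omega> * Y \<omega>) + (Y \<omega>)\<^sup>2) = (\<lambda>\<omega>. (D \<omega>)\<^sup>2)"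
      by (simp add: fun_eq_iff D_def power2_eq_square algebra_simps)
    ultimately show ?thesis by simp
  qed
  have XD: "(\<integral>\<omega>. X \<omega> z * D \<omega> \<partial>M) = 0" if z: "z \<in> space N" for z
  proof -
    have sq: "integrable M (\<lambda>\<omega>. (X \<omega> z)\<^sup>2)" using X2[OF z] by (simp add: has_bochner_integral_iff)
    have "(\<integral>\<omega>. X \<omega> z * D \<omega> \<partial>M) = (\<integral>\<omega>. Z \<omega> * X \<omega> z - Y \<omega> * X \<omega> z \<partial>M)"
      by (simp add: D_def algebra_simps)
    also have "\<dots> = (\<integral>\<omega>. Z \<omega> * X \<omega> z \<partial>M) - (\<integral>\<omega>. Y \<omega> * X \<omega> z \<partial>M)"
      using fubini[OF Xy[OF z] sq] integrable_mult_of_squares[OF Y Xy[OF z] Y2 sq]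
      by (intro Bochner_Integration.integral_diff) auto
    also have "\<dots> = 0"
      using fubini[OF Xy[OF z] sq] cov_X[OF z] by simp
    finally show ?thesis .
  qed
  have int_ZD: "integrable M (\<lambda>\<omega>. Z \<omega> * D \<omega>)" and "(\<integral>\<omega>. Z \<omega> * D \<omega> \<partial>M) = 0"
  proof -
    have "(\<integral>y. (\<integral>\<omega>. X \<omega> y * D \<omega> \<partial>M) \<partial>N) = (\<integral>y. 0 \<partial>N)"
      by (rule Bochner_Integration.integral_cong) (auto intro: XD)
    then show "integrable M (\<lambda>\<omega>. Z \<omega> * D \<omega>)" "(\<integral>\<omega>. Z \<omega> * D \<omega> \<partial>M) = 0"
      using fubini[OF D D2] by auto
  qed
  moreover have int_YD: "integrable M (\<lambda>\<omega>. Y \<omega> * D \<omega>)" and "(\<integral>\<omega>. Y \<omega> * D \<omega> \<partial>M) = 0"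
  proof -
    have *: "Y \<omega> * D \<omega> = Z \<omega> * Y \<omega> - (Y \<omega>)\<^sup>2" for \<omega>
      by (simp add: D_def power2_eq_square algebra_simps)
    show "integrable M (\<lambda>\<omega>. Y \<omega> * D \<omega>)" unfolding * using int_ZY Y2 by auto
    show "(\<integral>\<omega>. Y \<omega> * D \<omega> \<partial>M) = 0"
      unfolding * using int_ZY Y2 fubini[OF Y Y2] cov_Y by (subst Bochner_Integration.integral_diff) auto
  qed
  ultimately have "(\<integral>\<omega>. Z \<omega> * D \<omega> - Y \<omega> * D \<omega> \<partial>M) = 0"
    by (subst Bochner_Integration.integral_diff) auto
  then have "(\<integral>\<omega>. (D \<omega>)\<^sup>2 \<partial>M) = 0"
    by (simp add: D_def power2_eq_square algebra_simps)
  then have "AE \<omega> in M. (D \<omega>)\<^sup>2 = 0"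
    using D2 by (subst (asm) integral_nonneg_eq_0_iff_AE) auto
  then show ?thesis by (simp add: D_def Z_def)
qed

text \<open>The expectation of \<open>f (b Z)\<close>, where \<open>Z\<close> has the law of \<open>G_1 * \<eta>(0)\<close>: centred Gaussian with variance
  \<open>\<parallel>G_1\<parallel>\<^sup>2 = G_2(0) = 1 / (4\<pi>)\<close>.\<close>

definition gaussian_mean :: "(real \<Rightarrow> real) \<Rightarrow> real \<Rightarrow> real" where
  "gaussian_mean f b = (\<integral>z. normal_density 0 (sqrt (1 / (4 * pi))) z * f (b * z) \<partial>lborel)"

lemma deriv_rescaled:
  assumes "\<And>u. F differentiable (at u)" "s > 0"
  shows "deriv (rescaled F s) u = 1 / s * deriv F (sqrt s * u)"
proof (rule DERIV_imp_deriv)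
  have "(F has_real_derivative deriv F v) (at v)" for v
    using assms(1) by (simp add: DERIV_deriv_iff_real_differentiable)
  then have "((\<lambda>u. F (s powr (1/2) * u)) has_real_derivative
      deriv F (s powr (1/2) * u) * (s powr (1/2))) (at u)"
    by (rule DERIV_chain2) (auto intro!: derivative_eq_intros)
  then have "(rescaled F s has_real_derivative
      s powr (- 3/2) * (deriv F (s powr (1/2) * u) * s powr (1/2))) (at u)"
    unfolding rescaled_def by (rule DERIV_cmult)
  moreover have "s powr (- 3/2) * s powr (1/2) = 1 / s"
  proof -
    have "s powr (- 3/2) * s powr (1/2) = s powr (- 3/2 + 1/2)" by (rule powr_add[symmetric])
    also have "\<dots> = s powr (- 1)" by simp
    also have "\<dots> = 1 / s" using assms(2) by (simp add: powr_minus_divide)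
    finally show ?thesis .
  qed
  then have "s powr (- 3/2) * (deriv F (s powr (1/2) * u) * s powr (1/2)) =
      1 / s * deriv F (s powr (1/2) * u)" by (metis mult.assoc mult.commute)
  ultimately show "(rescaled F s has_real_derivative 1 / s * deriv F (sqrt s * u)) (at u)"
    using assms(2) by (simp add: powr_half_sqrt)
qed

context white_noise_on_plane
begin

lemma mollified_eq_smoothed: "mollified \<epsilon> (\<eta> \<omega>) x = smoothed (\<epsilon>\<^sup>2) x \<omega>"
  by (simp add: mollified_def conv_distr_def smoothed_def)

text \<open>All the covariances needed for \<open>random_average_eq_projection\<close> are values of the heat kernel, and
  averaging them in \<open>y\<close> adds \<open>t\<close> to the time parameter.\<close>

lemma heat_average_smoothed:
  assumes "s > 0" "t > 0"
  shows "AE \<omega> in M. (\<integral>y. heat_kernel t (x - y) * smoothed s y \<omega> \<partial>lborel) = smoothed (s + t) x \<omega>"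
proof -
  define N where "N = density lborel (\<lambda>y. ennreal (heat_kernel t (x - y)))"
  have sN: "space N = UNIV" "sets N = sets borel" by (auto simp: N_def)
  have N: "prob_space N"
    using nn_integral_heat_kernel[OF assms(2)]
    by (intro prob_spaceI) (simp add: N_def emeasure_density)
  have int_N: "(\<integral>y. f y \<partial>N) = (\<integral>y. heat_kernel t (x - y) * f y \<partial>lborel)"
    if "f \<in> borel_measurable borel" for f :: "plane \<Rightarrow> real"
    using that assms unfolding N_def by (subst integral_density) (auto intro: less_imp_le[OF heat_kernel_pos])
  have jm: "(\<lambda>(\<omega>, y). smoothed s y \<omega>) \<in> borel_measurable (M \<Otimes>\<^sub>M N)"
    using smoothed_jointly_measurable[OF assms(1)] sets_pair_measure_cong[of M M N lborel]
    by (simp add: N_def cong: measurable_cong_sets)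
  have cov: "(\<integral>\<omega>. smoothed u y \<omega> * smoothed v z \<omega> \<partial>M) = heat_kernel (u + v) (y - z)"
    if "u > 0" "v > 0" for u v y z
    using smoothed_covariance[OF that] by (simp add: has_bochner_integral_iff)
  have conv: "(\<integral>y. heat_kernel t (x - y) * heat_kernel u (y - z) \<partial>lborel) = heat_kernel (t + u) (x - z)"
    if "u > 0" for u z
  proof -
    have "heat_kernel u (y - z) = heat_kernel u (z - y)" for y
      using heat_kernel_minus[of u "z - y"] by simp
    then show ?thesis
      using heat_kernel_semigroup[OF assms(2) that, of x z] by (simp add: has_bochner_integral_iff)
  qed
  have "AE \<omega> in M. (\<integral>y. smoothed s y \<omega> \<partial>N) = smoothed (s + t) x \<omega>"
  proof (rule random_average_eq_projection[OF _ N jm])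
    show "prob_space M" by (rule prob_space_axioms)
    show "smoothed (s + t) x \<in> borel_measurable M"
      using assms borel_measurable_smoothed[of "s + t" x] by simp
    show "has_bochner_integral M (\<lambda>\<omega>. (smoothed s y \<omega>)\<^sup>2) (heat_kernel (s + s) 0)" for y
      using smoothed_covariance[OF assms(1) assms(1), of y y] by (simp add: power2_eq_square)
    show "integrable M (\<lambda>\<omega>. (smoothed (s + t) x \<omega>)\<^sup>2)"
      using smoothed_covariance[of "s + t" "s + t" x x] assms
      by (simp add: power2_eq_square has_bochner_integral_iff)
    show "(\<integral>y. (\<integral>\<omega>. smoothed s y \<omega> * smoothed s z \<omega> \<partial>M) \<partial>N) =
        (\<integral>\<omega>. smoothed (s + t) x \<omega> * smoothed s z \<omega> \<partial>M)" for z
      using assms by (simp add: cov int_N conv add_ac)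
    show "(\<integral>y. (\<integral>\<omega>. smoothed s y \<omega> * smoothed (s + t) x \<omega> \<partial>M) \<partial>N) =
        (\<integral>\<omega>. (smoothed (s + t) x \<omega>)\<^sup>2 \<partial>M)"
      using assms by (simp add: power2_eq_square cov int_N conv add_ac)
  qed
  then show ?thesis
    using AE_space
  proof eventually_elim
    case (elim \<omega>)
    have "(\<lambda>y. smoothed s y \<omega>) \<in> borel_measurable borel"
      using measurable_compose[OF measurable_Pair1'[OF elim(2)] smoothed_jointly_measurable[OF assms(1)]]
      by simp
    with elim show ?case by (simp add: int_N)
  qed
qed

text \<open>At \<open>t = 0\<close> the heat flow is the identity and the equality holds pointwise; for \<open>t > 0\<close> the mass
  contributes the factor \<open>exp (m * t)\<close>.\<close>

lemma heat_flow_mollified: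
  assumes "t \<ge> 0" "\<epsilon> > 0"
  shows "AE \<omega> in M. heat_flow m t (mollified \<epsilon> (\<eta> \<omega>)) x = exp (m * t) * smoothed (t + \<epsilon>\<^sup>2) x \<omega>"
proof (cases "t = 0")
  case True
  then show ?thesis by (simp add: heat_flow_def mollified_eq_smoothed)
next
  case False
  with assms have "AE \<omega> in M. (\<integral>y. heat_kernel t (x - y) * smoothed (\<epsilon>\<^sup>2) y \<omega> \<partial>lborel) = smoothed (\<epsilon>\<^sup>2 + t) x \<omega>"
    by (intro heat_average_smoothed) auto
  then show ?thesis
  proof eventually_elim
    case (elim \<omega>)
    with False show ?case
      by (simp add: heat_flow_def conv_def massive_heat_kernel_def mollified_eq_smoothed
          mult.assoc add.commute)
  qed
qed

lemma borel_measurable_heat_flow_mollified: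
  assumes "t \<ge> 0" "\<epsilon> > 0"
  shows "(\<lambda>\<omega>. heat_flow m t (mollified \<epsilon> (\<eta> \<omega>)) x) \<in> borel_measurable M"
proof (cases "t = 0")
  case True
  with assms borel_measurable_smoothed[of "\<epsilon>\<^sup>2" x] show ?thesis
    by (simp add: heat_flow_def mollified_eq_smoothed)
next
  case False
  have [measurable]: "(\<lambda>(\<omega>, y). smoothed (\<epsilon>\<^sup>2) y \<omega>) \<in> borel_measurable (M \<Otimes>\<^sub>M lborel)"
    using assms by (intro smoothed_jointly_measurable) simp
  have "(\<lambda>\<omega>. \<integral>y. exp (m * t) * heat_kernel t (x - y) * smoothed (\<epsilon>\<^sup>2) y \<omega> \<partial>lborel) \<in> borel_measurable M"
    by measurable
  with False show ?thesis
    by (simp add: heat_flow_def conv_def massive_heat_kernel_def mollified_eq_smoothed)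
qed

text \<open>The variance of \<open>smoothed s x\<close> is \<open>1 / (4\<pi>s)\<close>, so the factor \<open>sqrt s\<close> removes all dependence on
  the scale.\<close>

lemma scaled_smoothed_distributed:
  assumes "s > 0"
  shows "distributed M lborel (\<lambda>\<omega>. sqrt s * smoothed s x \<omega>) (normal_density 0 (sqrt (1 / (4 * pi))))"
proof -
  have "heat_kernel (2 * s) 0 > 0" using assms by (simp add: heat_kernel_pos)
  then have "distributed M lborel (\<lambda>\<omega>. 0 + sqrt s * smoothed s x \<omega>)
      (normal_density (0 + sqrt s * 0) (\<bar>sqrt s\<bar> * sqrt (heat_kernel (2 * s) 0)))"
    using assms by (intro normal_density_affine smoothed_distributed) auto
  moreover have "\<bar>sqrt s\<bar> * sqrt (heat_kernel (2 * s) 0) = sqrt (1 / (4 * pi))"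
    using assms by (simp add: heat_kernel_def flip: real_sqrt_mult)
  ultimately show ?thesis by simp
qed

lemma expectation_smoothed:
  assumes "s > 0" "f \<in> borel_measurable borel"
  shows "(\<integral>\<omega>. f (b * (sqrt s * smoothed s x \<omega>)) \<partial>M) = gaussian_mean f b"
  unfolding gaussian_mean_def
  using assms distributed_integral[OF scaled_smoothed_distributed[OF assms(1)], of "\<lambda>z. f (b * z)" x]
  by simp

text \<open>The scaling of the nonlinearity matches that of the noise: up to the prefactor, the expectation
  depends on \<open>t\<close> and \<open>\<epsilon>\<close> only through the massive factor.\<close>

lemma mean_slope_eq_gaussian_mean:
  assumes "t \<ge> 0" "\<epsilon> > 0" and F: "\<And>u. F differentiable (at u)" and [measurable]: "deriv F \<in> borel_measurable borel"
  shows "mean_slope M \<eta> m F x \<epsilon> t a = 1 / (t + \<epsilon>\<^sup>2) * gaussian_mean (deriv F) (a * exp (m * t))"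
proof -
  define s where "s = t + \<epsilon>\<^sup>2"
  have s: "s > 0" using assms by (simp add: s_def add_nonneg_pos)
  have [measurable]: "smoothed s x \<in> borel_measurable M" by (rule borel_measurable_smoothed[OF s])
  have "mean_slope M \<eta> m F x \<epsilon> t a =
      (\<integral>\<omega>. 1 / s * deriv F (sqrt s * (a * heat_flow m t (mollified \<epsilon> (\<eta> \<omega>)) x)) \<partial>M)"
    unfolding mean_slope_def s_def[symmetric] deriv_rescaled[OF F s] ..
  also have "\<dots> = (\<integral>\<omega>. 1 / s * deriv F (a * exp (m * t) * (sqrt s * smoothed s x \<omega>)) \<partial>M)"
  proof (rule integral_cong_AE)
    note [measurable] = borel_measurable_heat_flow_mollified[OF assms(1,2), of m x]
    show "(\<lambda>\<omega>. 1 / s * deriv F (sqrt s * (a * heat_flow m t (mollified \<epsilon> (\<eta> \<omega>)) x))) \<in> borel_measurable M"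
      by measurable
    show "(\<lambda>\<omega>. 1 / s * deriv F (a * exp (m * t) * (sqrt s * smoothed s x \<omega>))) \<in> borel_measurable M"
      by measurable
    show "AE \<omega> in M. 1 / s * deriv F (sqrt s * (a * heat_flow m t (mollified \<epsilon> (\<eta> \<omega>)) x)) =
        1 / s * deriv F (a * exp (m * t) * (sqrt s * smoothed s x \<omega>))"
      using heat_flow_mollified[OF assms(1,2), of m x]
      by eventually_elim (simp add: s_def mult_ac)
  qed
  also have "\<dots> = 1 / s * gaussian_mean (deriv F) (a * exp (m * t))"
    using s by (simp add: expectation_smoothed)
  finally show ?thesis by (simp add: s_def)
qed

end


section \<open>Growth of the nonlinearity and of its Gaussian means\<close>

text \<open>Local Lipschitz continuity on \<open>[-R, R]\<close> with an explicit constant.  The explicit growth in \<open>R\<close> is what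
  survives Gaussian averaging, and it is also what the differential equations use.\<close>

definition poly_lipschitz :: "real \<Rightarrow> nat \<Rightarrow> (real \<Rightarrow> real) \<Rightarrow> bool" where
  "poly_lipschitz C p f \<longleftrightarrow> C \<ge> 0 \<and>
     (\<forall>R u v. \<bar>u\<bar> \<le> R \<longrightarrow> \<bar>v\<bar> \<le> R \<longrightarrow> \<bar>f u - f v\<bar> \<le> C * (1 + R ^ p) * \<bar>u - v\<bar>)"

lemma poly_lipschitzD:
  "poly_lipschitz C p f \<Longrightarrow> \<bar>u\<bar> \<le> R \<Longrightarrow> \<bar>v\<bar> \<le> R \<Longrightarrow> \<bar>f u - f v\<bar> \<le> C * (1 + R ^ p) * \<bar>u - v\<bar>"
  by (simp add: poly_lipschitz_def)

lemma poly_lipschitz_bound: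
  assumes "poly_lipschitz C p f" "\<bar>u\<bar> \<le> R"
  shows "\<bar>f u\<bar> \<le> \<bar>f 0\<bar> + C * (1 + R ^ p) * R"
proof -
  have R: "R \<ge> 0" using assms(2) by linarith
  have "\<bar>f u - f 0\<bar> \<le> C * (1 + R ^ p) * \<bar>u - 0\<bar>"
    using assms R by (intro poly_lipschitzD) auto
  also have "\<dots> \<le> C * (1 + R ^ p) * R"
    using assms R by (intro mult_left_mono) (auto simp: poly_lipschitz_def)
  finally show ?thesis by linarith
qed

lemma poly_lipschitz_continuous:
  assumes "poly_lipschitz C p f"
  shows "continuous_on A f"
proof -
  have "isCont f x" for x
  proof -
    define R where "R = \<bar>x\<bar> + 1"
    have "(C * (1 + R ^ p))-lipschitz_on (ball x 1) f"
    proof (rule lipschitz_onI)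
      fix u v assume "u \<in> ball x 1" "v \<in> ball x 1"
      then show "dist (f u) (f v) \<le> C * (1 + R ^ p) * dist u v"
        using poly_lipschitzD[OF assms, of u R v] by (auto simp: R_def dist_real_def)
    next
      show "0 \<le> C * (1 + R ^ p)" using assms by (auto simp: poly_lipschitz_def R_def)
    qed
    then have "continuous_on (ball x 1) f" by (rule lipschitz_on_continuous_on)
    then show ?thesis by (simp add: continuous_on_eq_continuous_at)
  qed
  then show ?thesis by (simp add: continuous_at_imp_continuous_on)
qed

lemma deriv_odd_fun_even:
  assumes "odd_fun g" "g differentiable_on UNIV"
  shows "deriv g (- u) = deriv g u"
proof -
  have d: "(g has_real_derivative deriv g v) (at v)" for v
    using assms(2) by (simp add: DERIV_deriv_iff_real_differentiable differentiable_on_def)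
  have "((\<lambda>u. - g (- u)) has_real_derivative - (deriv g (- u) * - 1)) (at u)"
    by (intro DERIV_minus DERIV_chain2[OF d]) (auto intro!: derivative_eq_intros)
  moreover have "(\<lambda>u. - g (- u)) = g" using assms(1) by (auto simp: odd_fun_def)
  ultimately show ?thesis using d[of u] DERIV_unique by fastforce
qed

lemma powr_le_one_plus_power:
  fixes R \<gamma> :: real
  assumes "R \<ge> 0" "0 \<le> \<gamma>"
  shows "R powr \<gamma> \<le> 1 + R ^ nat \<lceil>\<gamma>\<rceil>"
proof (cases "R \<le> 1")
  case True
  then have "R powr \<gamma> \<le> 1" using assms by (simp add: powr_le1)
  moreover have "0 \<le> R ^ nat \<lceil>\<gamma>\<rceil>" using assms by simp
  ultimately show ?thesis by linarith
next
  case False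
  then have "R powr \<gamma> \<le> R powr real (nat \<lceil>\<gamma>\<rceil>)"
    using assms by (intro powr_mono) auto
  then show ?thesis using False by (simp add: powr_realpow)
qed

text \<open>Lower bound: \<open>F u + L1 * u\<close> is non-decreasing.  Lipschitz bound: the derivative of the odd second
  summand is even, so the hypotheses on \<open>[0, u]\<close> extend to \<open>[-u, u]\<close>.  The functions of class
  \<open>class_S\<close> may depend on time; since the sum does not, the decomposition at time \<open>1\<close> is used.\<close>

lemma class_S_derivative:
  assumes "(\<lambda>t. F) \<in> class_S"
  obtains C p K where "poly_lipschitz C p (deriv F)" "K \<ge> 0" "\<And>u. - K \<le> deriv F u"
    "\<And>u. F differentiable (at u)"
proof -
  obtain F1 F2 where F12: "F1 \<in> class_S1" "F2 \<in> class_S2" "\<forall>t>0. \<forall>u. F u = F1 t u + F2 t u"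
    using assms by (auto simp: class_S_def)
  define A where "A = F1 1"
  define B where "B = F2 1"
  obtain L1 L2 where L: "L1 \<ge> 0" "L2 \<ge> 0" "F1 \<in> class_S1_with L1 L2"
    using F12(1) by (auto simp: class_S1_def)
  then have A: "A differentiable_on UNIV" "L1-lipschitz_on UNIV A" "L2-lipschitz_on UNIV (deriv A)"
    by (auto simp: class_S1_with_def A_def)
  obtain \<gamma>1 \<gamma>2 l1 l2 where l: "\<gamma>2 \<ge> 1" "l2 \<ge> 0" "F2 \<in> class_S2_with \<gamma>1 \<gamma>2 l1 l2"
    using F12(2) by (auto simp: class_S2_def)
  then have B: "B differentiable_on UNIV" "mono B" "odd_fun B"
    "\<And>u. u \<ge> 0 \<Longrightarrow> (l2 * (1 + \<bar>u\<bar> powr \<gamma>2))-lipschitz_on {0..u} (deriv B)"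
    by (auto simp: class_S2_with_def B_def)
  have F: "F = (\<lambda>u. A u + B u)" using F12(3) by (auto simp: A_def B_def)
  have dA: "(A has_real_derivative deriv A u) (at u)" for u
    using A(1) by (simp add: DERIV_deriv_iff_real_differentiable differentiable_on_def)
  have dB: "(B has_real_derivative deriv B u) (at u)" for u
    using B(1) by (simp add: DERIV_deriv_iff_real_differentiable differentiable_on_def)
  have dF: "(F has_real_derivative deriv A u + deriv B u) (at u)" for u
    unfolding F by (intro DERIV_add dA dB)
  then have F': "deriv F u = deriv A u + deriv B u" for u by (rule DERIV_imp_deriv)
  have "- L1 \<le> deriv F u" for u
  proof -
    have "mono (\<lambda>u. F u + L1 * u)"
    proof (rule monoI)
      fix x y :: real assume "x \<le> y"
      then have "\<bar>A y - A x\<bar> \<le> L1 * (y - x)"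
        using lipschitz_onD[OF A(2), of y x] by (simp add: dist_real_def)
      with monoD[OF B(2) \<open>x \<le> y\<close>] show "F x + L1 * x \<le> F y + L1 * y"
        by (simp add: F algebra_simps abs_le_iff)
    qed
    moreover have "((\<lambda>u. F u + L1 * u) has_real_derivative deriv F u + L1) (at u)"
      unfolding F' by (auto intro!: derivative_eq_intros dF)
    ultimately have "0 \<le> deriv F u + L1"
      by (intro mono_on_imp_deriv_nonneg[where A = UNIV]) auto
    then show ?thesis by simp
  qed
  moreover have "poly_lipschitz (L2 + 2 * l2) (nat \<lceil>\<gamma>2\<rceil>) (deriv F)"
    unfolding poly_lipschitz_def
  proof (intro conjI allI impI)
    show "0 \<le> L2 + 2 * l2" using L l by simp
    fix R u v :: real assume uv: "\<bar>u\<bar> \<le> R" "\<bar>v\<bar> \<le> R"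
    then have R: "R \<ge> 0" by linarith
    \<comment> \<open>Oddness of \<open>B\<close> moves both points to the half-line.\<close>
    have even: "deriv B w = deriv B \<bar>w\<bar>" for w
      using deriv_odd_fun_even[OF B(3,1), of w] by (simp add: abs_if)
    have "\<bar>deriv B u - deriv B v\<bar> \<le> l2 * (1 + \<bar>R\<bar> powr \<gamma>2) * \<bar>\<bar>u\<bar> - \<bar>v\<bar>\<bar>"
      using lipschitz_onD[OF B(4)[OF R], of "\<bar>u\<bar>" "\<bar>v\<bar>"] uv even[of u] even[of v] R
      by (simp add: dist_real_def)
    also have "\<dots> \<le> l2 * (2 + R ^ nat \<lceil>\<gamma>2\<rceil>) * \<bar>u - v\<bar>"
      using R l powr_le_one_plus_power[of R \<gamma>2] by (intro mult_mono) auto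
    also have "\<dots> \<le> 2 * l2 * (1 + R ^ nat \<lceil>\<gamma>2\<rceil>) * \<bar>u - v\<bar>"
      using R l by (intro mult_right_mono) (auto simp: algebra_simps)
    finally have 1: "\<bar>deriv B u - deriv B v\<bar> \<le> 2 * l2 * (1 + R ^ nat \<lceil>\<gamma>2\<rceil>) * \<bar>u - v\<bar>" .
    have "\<bar>deriv A u - deriv A v\<bar> \<le> L2 * 1 * \<bar>u - v\<bar>"
      using lipschitz_onD[OF A(3), of u v] by (simp add: dist_real_def)
    also have "\<dots> \<le> L2 * (1 + R ^ nat \<lceil>\<gamma>2\<rceil>) * \<bar>u - v\<bar>"
      using R L by (intro mult_right_mono mult_left_mono) auto
    finally have "\<bar>deriv A u - deriv A v\<bar> \<le> L2 * (1 + R ^ nat \<lceil>\<gamma>2\<rceil>) * \<bar>u - v\<bar>" .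
    with 1 show "\<bar>deriv F u - deriv F v\<bar> \<le> (L2 + 2 * l2) * (1 + R ^ nat \<lceil>\<gamma>2\<rceil>) * \<bar>u - v\<bar>"
      unfolding F' distrib_right by linarith
  qed
  moreover have "F differentiable (at u)" for u
    using dF by (auto simp: real_differentiable_def)
  ultimately show ?thesis using that L(1) by blast
qed

lemma gaussian_mean_integrable:
  assumes f: "poly_lipschitz C p f"
  shows "integrable lborel (\<lambda>z. normal_density 0 (sqrt (1 / (4 * pi))) z * f (b * z))"
proof (rule Bochner_Integration.integrable_bound)
  let ?n = "normal_density 0 (sqrt (1 / (4 * pi)))"
  have mom: "integrable lborel (\<lambda>z. ?n z * \<bar>z\<bar> ^ k)" for k
    using integrable_normal_moment_abs[of "sqrt (1 / (4 * pi))" 0 k] by simp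
  show "integrable lborel (\<lambda>z. \<bar>f 0\<bar> * (?n z * \<bar>z\<bar> ^ 0) + C * \<bar>b\<bar> * (?n z * \<bar>z\<bar> ^ 1) +
      C * \<bar>b\<bar> ^ Suc p * (?n z * \<bar>z\<bar> ^ Suc p))"
    by (intro Bochner_Integration.integrable_add integrable_mult_right mom)
  have [measurable]: "f \<in> borel_measurable borel"
    by (intro borel_measurable_continuous_onI poly_lipschitz_continuous[OF f])
  show "(\<lambda>z. ?n z * f (b * z)) \<in> borel_measurable lborel" by measurable
  show "AE z in lborel. norm (?n z * f (b * z)) \<le> norm (\<bar>f 0\<bar> * (?n z * \<bar>z\<bar> ^ 0) +
      C * \<bar>b\<bar> * (?n z * \<bar>z\<bar> ^ 1) + C * \<bar>b\<bar> ^ Suc p * (?n z * \<bar>z\<bar> ^ Suc p))"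
  proof (intro AE_I2)
    fix z
    have "norm (?n z * f (b * z)) = ?n z * \<bar>f (b * z)\<bar>" by (simp add: abs_mult)
    also have "\<dots> \<le> ?n z * (\<bar>f 0\<bar> + C * (1 + \<bar>b * z\<bar> ^ p) * \<bar>b * z\<bar>)"
      by (intro mult_left_mono poly_lipschitz_bound[OF f]) auto
    also have "\<dots> = \<bar>f 0\<bar> * (?n z * \<bar>z\<bar> ^ 0) +
      C * \<bar>b\<bar> * (?n z * \<bar>z\<bar> ^ 1) + C * \<bar>b\<bar> ^ Suc p * (?n z * \<bar>z\<bar> ^ Suc p)"
      by (simp add: abs_mult power_mult_distrib algebra_simps)
    finally have "norm (?n z * f (b * z)) \<le> \<dots>" .
    then show "norm (?n z * f (b * z)) \<le> norm (\<bar>f 0\<bar> * (?n z * \<bar>z\<bar> ^ 0) +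
      C * \<bar>b\<bar> * (?n z * \<bar>z\<bar> ^ 1) + C * \<bar>b\<bar> ^ Suc p * (?n z * \<bar>z\<bar> ^ Suc p))"
      by (rule order_trans) (simp only: real_norm_def abs_ge_self)
  qed
qed

text \<open>For \<open>\<bar>a\<bar>, \<bar>b\<bar> \<le> R\<close> the integrand difference at \<open>z\<close> is at most
  \<open>C (1 + R^p \<bar>z\<bar>^p) \<bar>z\<bar> \<bar>a - b\<bar>\<close>, so absolute Gaussian moments of orders \<open>1\<close> and \<open>p + 1\<close> give the
  new constant while the exponent is preserved.\<close>

lemma gaussian_mean_poly_lipschitz:
  assumes f: "poly_lipschitz C p f"
  shows "\<exists>C'. poly_lipschitz C' p (gaussian_mean f)"
proof -
  let ?n = "normal_density 0 (sqrt (1 / (4 * pi)))"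
  have mom: "integrable lborel (\<lambda>z. ?n z * \<bar>z\<bar> ^ k)" for k
    using integrable_normal_moment_abs[of "sqrt (1 / (4 * pi))" 0 k] by simp
  define \<mu> where "\<mu> = (\<lambda>k. \<integral>z. ?n z * \<bar>z\<bar> ^ k \<partial>lborel)"
  have \<mu>: "\<mu> k \<ge> 0" for k unfolding \<mu>_def by (intro integral_nonneg_AE) auto
  have C: "C \<ge> 0" using f by (simp add: poly_lipschitz_def)
  have "poly_lipschitz (C * (\<mu> 1 + \<mu> (Suc p))) p (gaussian_mean f)"
    unfolding poly_lipschitz_def
  proof (intro conjI allI impI)
    show "0 \<le> C * (\<mu> 1 + \<mu> (Suc p))" using C \<mu> by simp
    fix R a b :: real assume ab: "\<bar>a\<bar> \<le> R" "\<bar>b\<bar> \<le> R"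
    then have R: "R \<ge> 0" by linarith
    have "\<bar>gaussian_mean f a - gaussian_mean f b\<bar> =
        \<bar>\<integral>z. ?n z * f (a * z) - ?n z * f (b * z) \<partial>lborel\<bar>"
      unfolding gaussian_mean_def
      by (subst Bochner_Integration.integral_diff) (auto intro!: gaussian_mean_integrable[OF f])
    also have "\<dots> \<le> (\<integral>z. C * \<bar>a - b\<bar> * (?n z * \<bar>z\<bar> ^ 1) +
        C * R ^ p * \<bar>a - b\<bar> * (?n z * \<bar>z\<bar> ^ Suc p) \<partial>lborel)"
    proof (rule order_trans[OF integral_abs_bound])
      show "(\<integral>z. \<bar>?n z * f (a * z) - ?n z * f (b * z)\<bar> \<partial>lborel) \<le>
          (\<integral>z. C * \<bar>a - b\<bar> * (?n z * \<bar>z\<bar> ^ 1) + C * R ^ p * \<bar>a - b\<bar> * (?n z * \<bar>z\<bar> ^ Suc p) \<partial>lborel)"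
      proof (rule integral_mono)
        show "integrable lborel (\<lambda>z. \<bar>?n z * f (a * z) - ?n z * f (b * z)\<bar>)"
          by (intro integrable_abs Bochner_Integration.integrable_diff gaussian_mean_integrable[OF f])
        show "integrable lborel (\<lambda>z. C * \<bar>a - b\<bar> * (?n z * \<bar>z\<bar> ^ 1) +
            C * R ^ p * \<bar>a - b\<bar> * (?n z * \<bar>z\<bar> ^ Suc p))"
          by (intro Bochner_Integration.integrable_add integrable_mult_right mom)
        fix z
        have "\<bar>?n z * f (a * z) - ?n z * f (b * z)\<bar> = ?n z * \<bar>f (a * z) - f (b * z)\<bar>"
          by (simp add: abs_mult flip: right_diff_distrib)
        also have "\<dots> \<le> ?n z * (C * (1 + (R * \<bar>z\<bar>) ^ p) * \<bar>a * z - b * z\<bar>)"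
          using ab by (intro mult_left_mono poly_lipschitzD[OF f]) (auto simp: abs_mult intro: mult_right_mono)
        also have "\<dots> = C * \<bar>a - b\<bar> * (?n z * \<bar>z\<bar> ^ 1) + C * R ^ p * \<bar>a - b\<bar> * (?n z * \<bar>z\<bar> ^ Suc p)"
          by (simp add: left_diff_distrib[symmetric] abs_mult power_mult_distrib) (simp add: algebra_simps)
        finally show "\<bar>?n z * f (a * z) - ?n z * f (b * z)\<bar> \<le>
            C * \<bar>a - b\<bar> * (?n z * \<bar>z\<bar> ^ 1) + C * R ^ p * \<bar>a - b\<bar> * (?n z * \<bar>z\<bar> ^ Suc p)" .
      qed
    qed
    also have "\<dots> = C * \<bar>a - b\<bar> * \<mu> 1 + C * R ^ p * \<bar>a - b\<bar> * \<mu> (Suc p)"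
      unfolding \<mu>_def
      by (subst Bochner_Integration.integral_add) (use mom[of 1] mom[of "Suc p"] in auto)
    also have "\<dots> \<le> C * (\<mu> 1 + \<mu> (Suc p)) * (1 + R ^ p) * \<bar>a - b\<bar>"
    proof -
      have "0 \<le> C * \<bar>a - b\<bar> * \<mu> (Suc p)" "0 \<le> C * R ^ p * \<bar>a - b\<bar> * \<mu> 1"
        using C R \<mu> by auto
      then show ?thesis by (simp add: algebra_simps)
    qed
    finally show "\<bar>gaussian_mean f a - gaussian_mean f b\<bar> \<le>
        C * (\<mu> 1 + \<mu> (Suc p)) * (1 + R ^ p) * \<bar>a - b\<bar>" .
  qed
  then show ?thesis ..
qed

lemma gaussian_mean_lower_bound:
  assumes "poly_lipschitz C p f" "\<And>u. - K \<le> f u"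
  shows "- K \<le> gaussian_mean f b"
proof -
  let ?n = "normal_density 0 (sqrt (1 / (4 * pi)))"
  have "(\<integral>z. ?n z * (- K) \<partial>lborel) \<le> gaussian_mean f b"
    unfolding gaussian_mean_def
    by (intro integral_mono gaussian_mean_integrable[OF assms(1)] integrable_mult_left mult_left_mono assms(2))
       auto
  then show ?thesis by simp
qed


section \<open>Scalar differential equations on the half-line\<close>

text \<open>The absolute value is not differentiable, so the argument runs with
  \<open>S = sqrt (d\<^sup>2 + \<delta>\<^sup>2) \<ge> \<bar>d\<bar>\<close>, which satisfies \<open>S' \<le> \<bar>d'\<bar> \<le> C S + b'\<close>.  Hence
  \<open>S e^(- C q) - b\<close> is non-increasing, and \<open>\<delta>\<close> can be sent to \<open>0\<close>.  The inhomogeneity is given through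
  its primitive \<open>b\<close>, which the application knows explicitly.\<close>

lemma gronwall:
  fixes d b d' b' :: "real \<Rightarrow> real"
  assumes d: "continuous_on {0..Q} d" "\<And>q. 0 < q \<Longrightarrow> q < Q \<Longrightarrow> DERIV d q :> d' q"
    and b: "continuous_on {0..Q} b" "\<And>q. 0 < q \<Longrightarrow> q < Q \<Longrightarrow> DERIV b q :> b' q"
    and bound: "\<And>q. 0 < q \<Longrightarrow> q < Q \<Longrightarrow> \<bar>d' q\<bar> \<le> C * \<bar>d q\<bar> + b' q"
    and b'_nonneg: "\<And>q. 0 < q \<Longrightarrow> q < Q \<Longrightarrow> 0 \<le> b' q"
    and C: "C \<ge> 0" and q: "0 \<le> q" "q \<le> Q"
  shows "\<bar>d q\<bar> \<le> exp (C * q) * (\<bar>d 0\<bar> + b q - b 0)"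
proof -
  have "\<bar>d q\<bar> * exp (- C * q) \<le> \<bar>d 0\<bar> + b q - b 0"
  proof (rule field_le_epsilon)
    fix \<delta> :: real assume \<delta>: "\<delta> > 0"
    define S where "S = (\<lambda>q. sqrt ((d q)\<^sup>2 + \<delta>\<^sup>2))"
    have pos: "(d r)\<^sup>2 + \<delta>\<^sup>2 > 0" for r using \<delta> by (simp add: add_nonneg_pos)
    have S_ge: "\<bar>d r\<bar> \<le> S r" for r
      unfolding S_def by (rule real_le_rsqrt) simp
    have S_pos: "S r > 0" for r unfolding S_def using pos by simp
    define h where "h = (\<lambda>q. S q * exp (- C * q) - b q)"
    have "h q \<le> h 0"
    proof (rule DERIV_nonpos_imp_decreasing_open[OF q(1)])
      show "continuous_on {0..q} h"
        unfolding h_def S_def using q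
        by (intro continuous_intros continuous_on_subset[OF d(1)] continuous_on_subset[OF b(1)]) auto
      fix r assume r: "0 < r" "r < q"
      then have rQ: "0 < r" "r < Q" using q by auto
      have "DERIV S r :> (d r * d' r) / S r"
        unfolding S_def using pos[of r]
        by (auto intro!: derivative_eq_intros d(2)[OF rQ] simp: field_simps)
      then have "DERIV h r :> (d r * d' r) / S r * exp (- C * r) - S r * (C * exp (- C * r)) - b' r"
        unfolding h_def by (auto intro!: derivative_eq_intros b(2)[OF rQ])
      moreover have "(d r * d' r) / S r * exp (- C * r) - S r * (C * exp (- C * r)) - b' r \<le> 0"
      proof -
        have "(d r * d' r) / S r \<le> \<bar>d' r\<bar>"
        proof -
          have "d r * d' r \<le> \<bar>d r\<bar> * \<bar>d' r\<bar>" by (simp add: abs_mult[symmetric])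
          also have "\<dots> \<le> S r * \<bar>d' r\<bar>" by (intro mult_right_mono S_ge) simp
          finally show ?thesis using S_pos[of r] by (simp add: divide_le_eq mult.commute)
        qed
        also have "\<dots> \<le> C * \<bar>d r\<bar> + b' r" by (rule bound[OF rQ])
        also have "\<dots> \<le> C * S r + b' r" using C S_ge by (simp add: mult_left_mono)
        finally have "(d r * d' r) / S r * exp (- C * r) \<le> (C * S r + b' r) * exp (- C * r)"
          by (rule mult_right_mono) simp
        moreover have "b' r * exp (- C * r) \<le> b' r * 1"
          using b'_nonneg[OF rQ] C r by (intro mult_left_mono) auto
        ultimately show ?thesis by (simp add: algebra_simps)
      qed
      ultimately show "\<exists>y. DERIV h r :> y \<and> y \<le> 0" by blast
    qed
    moreover have "S 0 \<le> \<bar>d 0\<bar> + \<delta>"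
      unfolding S_def using \<delta> by (intro real_le_lsqrt) (auto simp: power2_sum)
    moreover have "\<bar>d q\<bar> * exp (- C * q) \<le> S q * exp (- C * q)"
      by (intro mult_right_mono S_ge) simp
    moreover have "h q = S q * exp (- C * q) - b q" "h 0 = S 0 - b 0" by (simp_all add: h_def)
    ultimately show "\<bar>d q\<bar> * exp (- C * q) \<le> \<bar>d 0\<bar> + b q - b 0 + \<delta>"
      by linarith
  qed
  then have "\<bar>d q\<bar> * exp (- C * q) * exp (C * q) \<le> (\<bar>d 0\<bar> + b q - b 0) * exp (C * q)"
    by (rule mult_right_mono) simp
  moreover have "\<bar>d q\<bar> * exp (- C * q) * exp (C * q) = \<bar>d q\<bar>"
    by (simp add: mult.assoc flip: exp_add)
  ultimately show ?thesis unfolding mult.commute[of "exp (C * q)"] by linarith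
qed

lemma derivative_nonneg_imp_ge_initial:
  fixes f :: "real \<Rightarrow> real"
  assumes "\<And>t. t \<ge> 0 \<Longrightarrow> (f has_real_derivative f' t) (at t within {0..})"
    and "\<And>t. t \<ge> 0 \<Longrightarrow> f' t \<ge> 0" "t \<ge> 0"
  shows "f 0 \<le> f t"
proof (rule DERIV_nonneg_imp_increasing_open[OF assms(3)])
  show "continuous_on {0..t} f"
    by (rule continuous_on_subset[OF DERIV_continuous_on[OF assms(1)]]) auto
  fix r assume r: "0 < r" "r < t"
  have "at r within {0..} = at r" by (rule at_within_interior) (use r in auto)
  then show "\<exists>y. DERIV f r :> y \<and> 0 \<le> y" using assms(1)[of r] assms(2)[of r] r by auto
qed

lemma integral_has_real_derivative_halfline:
  fixes f :: "real \<Rightarrow> real"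
  assumes "continuous_on {0..} f" "t \<ge> 0"
  shows "((\<lambda>q. integral {0..q} f) has_real_derivative f t) (at t within {0..})"
proof -
  have "((\<lambda>q. integral {0..q} f) has_real_derivative f t) (at t within {0..t + 1})"
    using assms by (intro integral_has_real_derivative continuous_on_subset[OF assms(1)]) auto
  moreover have "at t within {0..t + 1} = at t within {0..}"
    by (rule at_within_nhd[where S = "{..<t + 1}"]) auto
  ultimately show ?thesis by simp
qed

text \<open>Picard iteration converges on the whole half-line at once in the weighted norm
  \<open>sup \<bar>w t\<bar> / E t\<close> with \<open>E t = exp (2 \<integral> L)\<close>: because \<open>\<integral> L E = (E - 1) / 2\<close>, the integral operator is a
  contraction with constant \<open>1 / 2\<close> for this norm, even though \<open>L\<close> may be unbounded.  The fixed point
  is sought as \<open>w = E y\<close> with \<open>y\<close> a bounded continuous function, extended to negative times by a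
  constant.\<close>

lemma picard_halfline:
  fixes g :: "real \<Rightarrow> real \<Rightarrow> real" and L :: "real \<Rightarrow> real"
  assumes g: "continuous_on ({0..} \<times> UNIV) (\<lambda>(s, x). g s x)" and L: "continuous_on {0..} L"
    and lip: "\<And>s x y. s \<ge> 0 \<Longrightarrow> \<bar>g s x - g s y\<bar> \<le> L s * \<bar>x - y\<bar>"
    and g0: "\<And>s. s \<ge> 0 \<Longrightarrow> \<bar>g s 0\<bar> \<le> L s"
  shows "\<exists>w. w 0 = 0 \<and> (\<forall>t\<ge>0. (w has_real_derivative g t (w t)) (at t within {0..}))"
proof -
  have L_nonneg: "L s \<ge> 0" if "s \<ge> 0" for s using g0[OF that] by linarith
  define E where "E = (\<lambda>q. exp (2 * integral {0..q} L))"
  have E_deriv: "(E has_real_derivative 2 * (L t * E t)) (at t within {0..})" if "t \<ge> 0" for t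
    unfolding E_def
    by (auto intro!: derivative_eq_intros integral_has_real_derivative_halfline[OF L that])
  have E_cont: "continuous_on {0..} E"
    by (rule DERIV_continuous_on[OF E_deriv]) auto
  have E_pos: "E q > 0" for q by (simp add: E_def)
  have E_ge: "E s \<ge> 1" if "s \<ge> 0" for s
    using derivative_nonneg_imp_ge_initial[of E "\<lambda>t. 2 * (L t * E t)" s] E_deriv L_nonneg E_pos that
    by (auto simp: E_def less_imp_le)
  have LE: "((\<lambda>s. L s * E s) has_integral (E q - 1) / 2) {0..q}" if "q \<ge> 0" for q
  proof -
    have "((\<lambda>s. L s * E s) has_integral E q / 2 - E 0 / 2) {0..q}"
    proof (rule fundamental_theorem_of_calculus[OF that])
      fix s assume s: "s \<in> {0..q}"
      have "((\<lambda>s. E s / 2) has_real_derivative L s * E s) (at s within {0..})"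
        using DERIV_cdivide[OF E_deriv[of s], of 2] s by simp
      then have "((\<lambda>s. E s / 2) has_real_derivative L s * E s) (at s within {0..q})"
        by (rule DERIV_subset) auto
      then show "((\<lambda>s. E s / 2) has_vector_derivative L s * E s) (at s within {0..q})"
        by (simp add: has_real_derivative_iff_has_vector_derivative)
    qed
    then show ?thesis by (simp add: E_def diff_divide_distrib)
  qed
  have int_bound: "\<bar>integral {0..q} h\<bar> / E q \<le> B / 2"
    if q: "q \<ge> 0" and h: "continuous_on {0..q} h" "\<And>s. s \<in> {0..q} \<Longrightarrow> \<bar>h s\<bar> \<le> B * (L s * E s)"
      and B: "B \<ge> 0" for q h B
  proof -
    have "((\<lambda>s. B * (L s * E s)) has_integral B * ((E q - 1) / 2)) {0..q}"
      by (rule has_integral_mult_right[OF LE[OF q]])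
    then have ig: "(\<lambda>s. B * (L s * E s)) integrable_on {0..q}"
      and eq: "integral {0..q} (\<lambda>s. B * (L s * E s)) = B * ((E q - 1) / 2)"
      by (simp_all only: has_integral_iff)
    have "norm (integral {0..q} h) \<le> integral {0..q} (\<lambda>s. B * (L s * E s))"
      by (rule integral_norm_bound_integral[OF integrable_continuous_interval[OF h(1)] ig])
         (use h(2) in auto)
    also note eq
    also have "B * ((E q - 1) / 2) \<le> B / 2 * E q" using B by (simp add: field_simps)
    finally show ?thesis using E_pos[of q] by (simp add: divide_le_eq)
  qed
  define G where "G = (\<lambda>(y::real \<Rightarrow>\<^sub>C real) s. g s (E s * apply_bcontfun y s))"
  have G_cont: "continuous_on {0..} (G y)" for y
  proof -
    have "continuous_on {0..} ((\<lambda>(s, x). g s x) \<circ> (\<lambda>s. (s, E s * apply_bcontfun y s)))"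
      by (intro continuous_on_compose continuous_intros E_cont continuous_on_subset[OF g]) auto
    then show ?thesis by (simp add: G_def o_def)
  qed
  define I where "I = (\<lambda>y q. integral {0..q} (G y))"
  have I_deriv: "(I y has_real_derivative G y t) (at t within {0..})" if "t \<ge> 0" for y t
    unfolding I_def by (rule integral_has_real_derivative_halfline[OF G_cont that])
  define \<Phi> where "\<Phi> = (\<lambda>y q. I y (max 0 q) / E (max 0 q))"
  have "\<Phi> y \<in> bcontfun" for y
  proof (rule bcontfun_normI)
    have I_cont: "continuous_on {0..} (I y)" by (rule DERIV_continuous_on[OF I_deriv]) auto
    have "continuous_on UNIV ((\<lambda>q. I y q / E q) \<circ> (\<lambda>q. max 0 q))"
      by (intro continuous_on_compose continuous_intros continuous_on_subset[OF I_cont]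
          continuous_on_subset[OF E_cont]) (auto simp: E_def)
    then show "continuous_on UNIV (\<Phi> y)" by (simp add: \<Phi>_def o_def)
    fix q
    have "\<bar>I y (max 0 q)\<bar> / E (max 0 q) \<le> (1 + norm y) / 2"
      unfolding I_def
    proof (rule int_bound)
      show "continuous_on {0..max 0 q} (G y)" by (rule continuous_on_subset[OF G_cont]) auto
      fix s assume "s \<in> {0..max 0 q}"
      then have s: "s \<ge> 0" by simp
      have "\<bar>G y s\<bar> \<le> \<bar>g s (E s * y s) - g s 0\<bar> + \<bar>g s 0\<bar>" unfolding G_def by linarith
      also have "\<dots> \<le> L s * \<bar>E s * y s - 0\<bar> + L s" by (intro add_mono lip g0 s)
      also have "\<dots> = L s * (E s * \<bar>y s\<bar>) + L s * 1" using E_pos[of s] by (simp add: abs_mult)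
      also have "\<dots> \<le> L s * (E s * norm y) + L s * E s"
        using norm_bounded[of y s] E_ge[OF s] E_pos[of s] L_nonneg[OF s]
        by (intro add_mono mult_left_mono) auto
      finally show "\<bar>G y s\<bar> \<le> (1 + norm y) * (L s * E s)" by (simp add: algebra_simps)
    qed auto
    then show "norm (\<Phi> y q) \<le> (1 + norm y) / 2"
      using E_pos by (simp add: \<Phi>_def abs_of_pos)
  qed
  then have \<Phi>_apply: "apply_bcontfun (Bcontfun (\<Phi> y)) = \<Phi> y" for y by (simp add: Bcontfun_inverse)
  have "dist (Bcontfun (\<Phi> y)) (Bcontfun (\<Phi> z)) \<le> 1 / 2 * dist y z" for y z
  proof (rule dist_bound)
    fix q :: real
    let ?q = "max 0 q"
    have ig: "G u integrable_on {0..?q}" for u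
      by (intro integrable_continuous_interval continuous_on_subset[OF G_cont]) auto
    have "\<bar>integral {0..?q} (\<lambda>s. G y s - G z s)\<bar> / E ?q \<le> dist y z / 2"
    proof (rule int_bound)
      show "continuous_on {0..?q} (\<lambda>s. G y s - G z s)"
        by (intro continuous_intros continuous_on_subset[OF G_cont]) auto
      fix s assume "s \<in> {0..?q}"
      then have s: "s \<ge> 0" by simp
      have "\<bar>G y s - G z s\<bar> \<le> L s * \<bar>E s * y s - E s * z s\<bar>" unfolding G_def by (rule lip[OF s])
      also have "\<dots> = L s * E s * dist (y s) (z s)"
        using E_pos[of s] by (simp add: dist_real_def abs_mult flip: right_diff_distrib)
      also have "\<dots> \<le> L s * E s * dist y z"
        using L_nonneg[OF s] E_pos[of s] by (intro mult_left_mono dist_bounded) auto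
      finally show "\<bar>G y s - G z s\<bar> \<le> dist y z * (L s * E s)" by (simp add: mult_ac)
    qed auto
    then have "\<bar>(I y ?q - I z ?q) / E ?q\<bar> \<le> dist y z / 2"
      using ig E_pos[of ?q] by (simp add: I_def integral_diff)
    then show "dist (apply_bcontfun (Bcontfun (\<Phi> y)) q) (apply_bcontfun (Bcontfun (\<Phi> z)) q) \<le> 1 / 2 * dist y z"
      unfolding \<Phi>_apply by (simp add: \<Phi>_def dist_real_def diff_divide_distrib)
  qed
  then obtain y where y: "Bcontfun (\<Phi> y) = y"
    using banach_fix_type[of "1 / 2" "\<lambda>y. Bcontfun (\<Phi> y)"] by auto
  have fixpoint: "E t * y t = I y t" if "t \<ge> 0" for t
  proof -
    have "y t = \<Phi> y t" using \<Phi>_apply[of y] y by simp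
    then show ?thesis using that E_pos[of t] by (simp add: \<Phi>_def)
  qed
  show ?thesis
  proof (intro exI[of _ "I y"] conjI allI impI)
    show "I y 0 = 0" by (simp add: I_def)
    fix t :: real assume t: "t \<ge> 0"
    show "(I y has_real_derivative g t (I y t)) (at t within {0..})"
      using I_deriv[OF t, of y] by (simp add: G_def fixpoint[OF t])
  qed
qed


section \<open>Multiplicative decay equations\<close>

text \<open>Comparing \<open>H u * x\<close> with \<open>H v * y\<close> serves both uniqueness, where \<open>u\<close> and \<open>v\<close> are the same multiple of
  \<open>x\<close> and \<open>y\<close>, and the comparison with the limit, where the multiples differ.\<close>

lemma slope_term_lipschitz:
  assumes H: "poly_lipschitz C p H" and u: "\<bar>u\<bar> \<le> R" "\<bar>v\<bar> \<le> R" and x: "\<bar>x\<bar> \<le> B"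
  shows "\<bar>H u * x - H v * y\<bar> \<le> C * (1 + R ^ p) * B * \<bar>u - v\<bar> + (\<bar>H 0\<bar> + C * (1 + R ^ p) * R) * \<bar>x - y\<bar>"
proof -
  have R: "R \<ge> 0" and C: "C \<ge> 0" using u H by (auto simp: poly_lipschitz_def)
  have "H u * x - H v * y = (H u - H v) * x + H v * (x - y)" by (simp add: algebra_simps)
  then have "\<bar>H u * x - H v * y\<bar> \<le> \<bar>H u - H v\<bar> * \<bar>x\<bar> + \<bar>H v\<bar> * \<bar>x - y\<bar>"
    by (simp add: abs_mult[symmetric] abs_triangle_ineq)
  also have "\<bar>H u - H v\<bar> * \<bar>x\<bar> \<le> (C * (1 + R ^ p) * \<bar>u - v\<bar>) * B"
    using C R by (intro mult_mono poly_lipschitzD[OF H] u x) auto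
  also have "\<bar>H v\<bar> * \<bar>x - y\<bar> \<le> (\<bar>H 0\<bar> + C * (1 + R ^ p) * R) * \<bar>x - y\<bar>"
    by (intro mult_right_mono poly_lipschitz_bound[OF H] u) auto
  finally show ?thesis by (simp add: mult_ac)
qed

text \<open>The equation \<open>\<sigma>' = - a(t) H(c(t) \<sigma>) \<sigma>\<close>, which covers both the approximating and the limiting
  problem.  The primitive \<open>A\<close> of \<open>a\<close> is a parameter because the bound on the solution is stated with it.\<close>

locale slope_equation =
  fixes H :: "real \<Rightarrow> real" and C :: real and p :: nat and K :: real
    and a A c :: "real \<Rightarrow> real"
  assumes H: "poly_lipschitz C p H" and H_ge: "\<And>b. - K \<le> H b" and K: "K \<ge> 0"
    and A0: "A 0 = 0" and A: "\<And>t. t \<ge> 0 \<Longrightarrow> (A has_real_derivative a t) (at t within {0..})"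
    and a_cont: "continuous_on {0..} a" and a_nonneg: "\<And>t. t \<ge> 0 \<Longrightarrow> a t \<ge> 0"
    and c_cont: "continuous_on {0..} c" and c_pos: "\<And>t. t \<ge> 0 \<Longrightarrow> c t > 0"
begin

definition solution :: "(real \<Rightarrow> real) \<Rightarrow> bool" where
  "solution \<sigma> \<longleftrightarrow> \<sigma> 0 = 1 \<and>
     (\<forall>t\<ge>0. (\<sigma> has_real_derivative - (a t * (H (c t * \<sigma> t) * \<sigma> t))) (at t within {0..}))"

lemma A_nonneg: "t \<ge> 0 \<Longrightarrow> A t \<ge> 0"
  using derivative_nonneg_imp_ge_initial[of A a t] A a_nonneg A0 by auto

lemma A_cont: "continuous_on {0..} A"
  by (rule DERIV_continuous_on[OF A]) auto

text \<open>With \<open>\<sigma> = e^w\<close> the equation becomes \<open>w' = - a(t) H(c(t) e^w)\<close>.  As \<open>H \<ge> - K\<close>, any solution obeys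
  \<open>w \<le> K A(t)\<close>, so \<open>w\<close> may be replaced by \<open>min w (K A(t))\<close> on the right-hand side; after
  that truncation the right-hand side is globally Lipschitz in \<open>w\<close> with a constant continuous in \<open>t\<close>, and
  \<open>picard_halfline\<close> applies.  Positivity and the upper bound of \<open>\<sigma>\<close> come for free.\<close>

lemma ex_solution: "\<exists>\<sigma>. solution \<sigma> \<and> (\<forall>t\<ge>0. 0 < \<sigma> t \<and> \<sigma> t \<le> exp (K * A t))"
proof -
  \<comment> \<open>The truncated argument of \<open>H\<close>, which lies in \<open>(0, R t]\<close>.\<close>
  define b where "b = (\<lambda>t x. c t * exp (min x (K * A t)))"
  define g where "g = (\<lambda>t x. - (a t * H (b t x)))"
  define R where "R = (\<lambda>t. c t * exp (K * A t))"
  define L where "L = (\<lambda>t. a t * (C * (1 + R t ^ p) * R t + \<bar>H (c t)\<bar>))"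
  have C: "C \<ge> 0" using H by (simp add: poly_lipschitz_def)
  have H_cont: "continuous_on S H" for S by (rule poly_lipschitz_continuous[OF H])
  have b_abs: "\<bar>b t x\<bar> \<le> R t" if "t \<ge> 0" for t x
    using c_pos[OF that] by (simp add: b_def R_def abs_mult)
  have "\<exists>w. w 0 = 0 \<and> (\<forall>t\<ge>0. (w has_real_derivative g t (w t)) (at t within {0..}))"
  proof (rule picard_halfline)
    have fst_cont: "continuous_on ({0..} \<times> UNIV) (\<lambda>z. f (fst z))"
      if "continuous_on {0..} f" for f :: "real \<Rightarrow> real"
      using that by (rule continuous_on_compose2) (auto intro!: continuous_intros)
    have "continuous_on ({0..} \<times> UNIV) (\<lambda>z. b (fst z) (snd z))"
      unfolding b_def
      by (intro continuous_intros fst_cont c_cont A_cont)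
    then have "continuous_on ({0..} \<times> UNIV) (\<lambda>z. H (b (fst z) (snd z)))"
      by (rule continuous_on_compose2[OF H_cont[of UNIV]]) auto
    then show "continuous_on ({0..} \<times> UNIV) (\<lambda>(s, x). g s x)"
      unfolding g_def case_prod_unfold by (intro continuous_intros fst_cont a_cont)
    have "continuous_on {0..} (\<lambda>t. H (c t))"
      by (rule continuous_on_compose2[OF H_cont[of UNIV] c_cont]) auto
    then show "continuous_on {0..} L"
      unfolding L_def R_def by (intro continuous_intros a_cont c_cont A_cont)
    fix s x y :: real assume s: "s \<ge> 0"
    have R: "R s \<ge> 0" using c_pos[OF s] by (simp add: R_def)
    have "\<bar>exp u - exp v\<bar> \<le> exp M * \<bar>u - v\<bar>" if "u \<le> M" "v \<le> M" for u v M :: real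
    proof -
      have "\<bar>exp u - exp v\<bar> \<le> exp M * \<bar>u - v\<bar>" if uv: "v \<le> u" "u \<le> M" for u v :: real
      proof -
        have "exp u - exp v = exp u * (1 - exp (v - u))" by (simp add: algebra_simps flip: exp_add)
        also have "\<dots> \<le> exp u * (u - v)"
        proof (rule mult_left_mono)
          show "1 - exp (v - u) \<le> u - v" using exp_ge_add_one_self[of "v - u"] by linarith
        qed simp
        also have "\<dots> \<le> exp M * (u - v)" using uv by (intro mult_right_mono) auto
        finally show ?thesis using uv by simp
      qed
      from this[of v u] this[of u v] that show ?thesis by (cases "v \<le> u") (auto simp: abs_minus_commute)
    qed
    then have "\<bar>exp (min x (K * A s)) - exp (min y (K * A s))\<bar> \<le>
        exp (K * A s) * \<bar>min x (K * A s) - min y (K * A s)\<bar>" by simp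
    also have "\<dots> \<le> exp (K * A s) * \<bar>x - y\<bar>" by (intro mult_left_mono) auto
    finally have "\<bar>b s x - b s y\<bar> \<le> R s * \<bar>x - y\<bar>"
      using c_pos[OF s] by (simp add: b_def R_def abs_mult flip: right_diff_distrib)
    then have "C * (1 + R s ^ p) * \<bar>b s x - b s y\<bar> \<le> C * (1 + R s ^ p) * (R s * \<bar>x - y\<bar>)"
      using C R by (intro mult_left_mono) auto
    with poly_lipschitzD[OF H b_abs[OF s, of x] b_abs[OF s, of y]]
    have "\<bar>H (b s x) - H (b s y)\<bar> \<le> C * (1 + R s ^ p) * R s * \<bar>x - y\<bar>" by simp
    also have "\<dots> \<le> (C * (1 + R s ^ p) * R s + \<bar>H (c s)\<bar>) * \<bar>x - y\<bar>"
      by (intro mult_right_mono) auto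
    finally have "a s * \<bar>H (b s x) - H (b s y)\<bar> \<le>
        a s * ((C * (1 + R s ^ p) * R s + \<bar>H (c s)\<bar>) * \<bar>x - y\<bar>)"
      by (intro mult_left_mono a_nonneg s)
    moreover have "\<bar>g s x - g s y\<bar> = a s * \<bar>H (b s x) - H (b s y)\<bar>"
    proof -
      have "g s x - g s y = - (a s * (H (b s x) - H (b s y)))" by (simp add: g_def algebra_simps)
      then show ?thesis using a_nonneg[OF s] by (simp add: abs_mult)
    qed
    ultimately show "\<bar>g s x - g s y\<bar> \<le> L s * \<bar>x - y\<bar>" by (simp add: L_def mult.assoc)
    have "b s 0 = c s" using A_nonneg[OF s] K by (simp add: b_def)
    then have "\<bar>g s 0\<bar> = a s * \<bar>H (c s)\<bar>" using a_nonneg[OF s] by (simp add: g_def abs_mult)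
    also have "\<dots> \<le> L s"
      unfolding L_def using a_nonneg[OF s] C R by (intro mult_left_mono) auto
    finally show "\<bar>g s 0\<bar> \<le> L s" .
  qed
  then obtain w where w0: "w 0 = 0"
    and w: "\<And>t. t \<ge> 0 \<Longrightarrow> (w has_real_derivative g t (w t)) (at t within {0..})" by blast
  have w_le: "w t \<le> K * A t" if "t \<ge> 0" for t
  proof -
    have "((\<lambda>t. K * A t - w t) has_real_derivative K * a t - g t (w t)) (at t within {0..})"
      if "t \<ge> 0" for t
      by (intro DERIV_diff DERIV_cmult A w that)
    moreover have "K * a t - g t (w t) \<ge> 0" if "t \<ge> 0" for t
    proof -
      have "0 \<le> a t * (K + H (b t (w t)))"
        using a_nonneg[OF that] H_ge[of "b t (w t)"] by (intro mult_nonneg_nonneg) auto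
      then show ?thesis by (simp add: g_def algebra_simps)
    qed
    ultimately have "K * A 0 - w 0 \<le> K * A t - w t"
      using that by (rule derivative_nonneg_imp_ge_initial)
    then show ?thesis by (simp add: A0 w0)
  qed
  have "solution (\<lambda>t. exp (w t))"
    unfolding solution_def
  proof (intro conjI allI impI)
    show "exp (w 0) = 1" by (simp add: w0)
    fix t :: real assume t: "t \<ge> 0"
    have "((\<lambda>t. exp (w t)) has_real_derivative exp (w t) * g t (w t)) (at t within {0..})"
      by (auto intro!: derivative_eq_intros w[OF t])
    moreover have "exp (w t) * g t (w t) = - (a t * (H (c t * exp (w t)) * exp (w t)))"
      using w_le[OF t] by (simp add: g_def b_def min_absorb1)
    ultimately show "((\<lambda>t. exp (w t)) has_real_derivative
        - (a t * (H (c t * exp (w t)) * exp (w t)))) (at t within {0..})" by simp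
  qed
  then show ?thesis using w_le by (intro exI[of _ "\<lambda>t. exp (w t)"]) auto
qed

text \<open>A solution is continuous, hence bounded on \<open>[0, Q]\<close>, and on bounded sets the right-hand side is
  Lipschitz, so the Gronwall inequality applies to the difference of two solutions.\<close>

lemma solution_unique:
  assumes \<sigma>: "solution \<sigma>" and \<tau>: "solution \<tau>" and Q: "Q \<ge> 0"
  shows "\<sigma> Q = \<tau> Q"
proof -
  have deriv: "(f has_real_derivative - (a t * (H (c t * f t) * f t))) (at t within {0..})"
    if "solution f" "t \<ge> 0" for f t
    using that by (simp add: solution_def)
  have cont: "continuous_on {0..Q} f" if "solution f" for f
    using DERIV_continuous_on[OF deriv[OF that]] by (rule continuous_on_subset) auto
  have bdd: "\<exists>B\<ge>0. \<forall>t\<in>{0..Q}. \<bar>f t\<bar> \<le> B" if "continuous_on {0..Q} f" for f :: "real \<Rightarrow> real"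
  proof -
    have "bounded (f ` {0..Q})" by (rule compact_imp_bounded[OF compact_continuous_image[OF that]]) simp
    then obtain B where "\<forall>t\<in>{0..Q}. \<bar>f t\<bar> \<le> B" by (auto simp: bounded_iff)
    then show ?thesis using Q by (intro exI[of _ B]) (auto intro: order_trans[OF abs_ge_zero, of "f 0"])
  qed
  obtain S where S: "S \<ge> 0" "\<And>t. t \<in> {0..Q} \<Longrightarrow> \<bar>\<sigma> t\<bar> \<le> S" using bdd[OF cont[OF \<sigma>]] by auto
  obtain T where T: "T \<ge> 0" "\<And>t. t \<in> {0..Q} \<Longrightarrow> \<bar>\<tau> t\<bar> \<le> T" using bdd[OF cont[OF \<tau>]] by auto
  have "continuous_on {0..Q} a" by (rule continuous_on_subset[OF a_cont]) auto
  from bdd[OF this] obtain a' where a': "a' \<ge> 0" "\<And>t. t \<in> {0..Q} \<Longrightarrow> \<bar>a t\<bar> \<le> a'" by auto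
  have "continuous_on {0..Q} c" by (rule continuous_on_subset[OF c_cont]) auto
  from bdd[OF this] obtain c' where c': "c' \<ge> 0" "\<And>t. t \<in> {0..Q} \<Longrightarrow> \<bar>c t\<bar> \<le> c'" by auto
  define B where "B = S + T"
  define R where "R = c' * B"
  \<comment> \<open>The Lipschitz constant of the product \<open>H (c t * x) * x\<close> for \<open>\<bar>x\<bar> \<le> B\<close>.\<close>
  define N where "N = C * (1 + R ^ p) * B * c' + (\<bar>H 0\<bar> + C * (1 + R ^ p) * R)"
  have C: "C \<ge> 0" using H by (simp add: poly_lipschitz_def)
  have B: "B \<ge> 0" and R: "R \<ge> 0" using S T c' by (auto simp: B_def R_def)
  have N: "N \<ge> 0" using C B R c' by (simp add: N_def)
  have "\<bar>\<sigma> Q - \<tau> Q\<bar> \<le> exp (a' * N * Q) * (\<bar>\<sigma> 0 - \<tau> 0\<bar> + 0 - 0)"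
  proof (rule gronwall[where d' = "\<lambda>t. - (a t * (H (c t * \<sigma> t) * \<sigma> t)) - - (a t * (H (c t * \<tau> t) * \<tau> t))"
        and b = "\<lambda>_. 0" and b' = "\<lambda>_. 0" and Q = Q])
    show "continuous_on {0..Q} (\<lambda>t. \<sigma> t - \<tau> t)" by (intro continuous_intros cont \<sigma> \<tau>)
    fix t assume t: "0 < t" "t < Q"
    have "at t within {0..} = at t" by (rule at_within_interior) (use t in auto)
    then show "DERIV (\<lambda>t. \<sigma> t - \<tau> t) t :>
        - (a t * (H (c t * \<sigma> t) * \<sigma> t)) - - (a t * (H (c t * \<tau> t) * \<tau> t))"
      using DERIV_diff[OF deriv[OF \<sigma>, of t] deriv[OF \<tau>, of t]] t by simp
    have tQ: "t \<in> {0..Q}" using t by simp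
    have "\<bar>c t * \<sigma> t\<bar> \<le> R" "\<bar>c t * \<tau> t\<bar> \<le> R"
      unfolding R_def abs_mult using c' c'(2)[OF tQ] S(2)[OF tQ] T(2)[OF tQ] S T
      by (auto intro!: mult_mono simp: B_def)
    then have "\<bar>H (c t * \<sigma> t) * \<sigma> t - H (c t * \<tau> t) * \<tau> t\<bar> \<le>
        C * (1 + R ^ p) * B * \<bar>c t * \<sigma> t - c t * \<tau> t\<bar> + (\<bar>H 0\<bar> + C * (1 + R ^ p) * R) * \<bar>\<sigma> t - \<tau> t\<bar>"
      using S(2)[OF tQ] T by (intro slope_term_lipschitz[OF H]) (auto simp: B_def)
    also have "\<dots> \<le> C * (1 + R ^ p) * B * (c' * \<bar>\<sigma> t - \<tau> t\<bar>) + (\<bar>H 0\<bar> + C * (1 + R ^ p) * R) * \<bar>\<sigma> t - \<tau> t\<bar>"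
    proof -
      have "\<bar>c t * \<sigma> t - c t * \<tau> t\<bar> = \<bar>c t\<bar> * \<bar>\<sigma> t - \<tau> t\<bar>"
        by (simp add: abs_mult flip: right_diff_distrib)
      also have "\<dots> \<le> c' * \<bar>\<sigma> t - \<tau> t\<bar>" using c'(2)[OF tQ] by (intro mult_right_mono) auto
      finally show ?thesis using C B R by (intro add_right_mono mult_left_mono) auto
    qed
    also have "\<dots> = N * \<bar>\<sigma> t - \<tau> t\<bar>" by (simp add: N_def algebra_simps)
    finally have "\<bar>a t\<bar> * \<bar>H (c t * \<sigma> t) * \<sigma> t - H (c t * \<tau> t) * \<tau> t\<bar> \<le> a' * (N * \<bar>\<sigma> t - \<tau> t\<bar>)"
      using a' a'(2)[OF tQ] by (intro mult_mono) auto
    moreover have "- (a t * (H (c t * \<sigma> t) * \<sigma> t)) - - (a t * (H (c t * \<tau> t) * \<tau> t)) =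
        - (a t * (H (c t * \<sigma> t) * \<sigma> t - H (c t * \<tau> t) * \<tau> t))" by (simp add: algebra_simps)
    ultimately show "\<bar>- (a t * (H (c t * \<sigma> t) * \<sigma> t)) - - (a t * (H (c t * \<tau> t) * \<tau> t))\<bar>
        \<le> a' * N * \<bar>\<sigma> t - \<tau> t\<bar> + 0" by (simp add: abs_mult mult.assoc)
  qed (use a' N Q in auto)
  then show ?thesis using \<sigma> \<tau> by (simp add: solution_def)
qed

lemma ex_unique_solution:
  "\<exists>\<sigma>. unique_solution solution \<sigma> \<and> (\<forall>t\<ge>0. 0 < \<sigma> t \<and> \<sigma> t \<le> exp (K * A t))"
  using ex_solution solution_unique unfolding unique_solution_def by blast

end


section \<open>Passage to the logarithmic clock\<close>

text \<open>As \<open>q\<close> runs from \<open>0\<close> to \<open>2\<close>, the scale \<open>t + \<epsilon>\<^sup>2\<close> runs geometrically from \<open>\<epsilon>\<^sup>2\<close> to \<open>1\<close>.\<close>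

definition log_clock :: "real \<Rightarrow> real \<Rightarrow> real" where
  "log_clock \<epsilon> q = \<epsilon> powr (2 - q) - \<epsilon>\<^sup>2"

lemma log_clock_bounds:
  assumes "0 < \<epsilon>" "\<epsilon> < 1"
  shows "q \<ge> 0 \<Longrightarrow> log_clock \<epsilon> q \<ge> 0" "q > 0 \<Longrightarrow> log_clock \<epsilon> q > 0" "q \<le> 2 \<Longrightarrow> log_clock \<epsilon> q \<le> 1"
    "log_clock \<epsilon> q \<le> \<epsilon> powr (2 - q)"
proof -
  have sq: "\<epsilon>\<^sup>2 = \<epsilon> powr 2" using assms by simp
  show "log_clock \<epsilon> q \<ge> 0" if "q \<ge> 0"
    using that assms powr_mono'[of "2 - q" 2 \<epsilon>] unfolding log_clock_def sq by simp
  show "log_clock \<epsilon> q > 0" if "q > 0"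
    using that assms powr_less_mono'[of \<epsilon> "2 - q" 2] unfolding log_clock_def sq by simp
  show "log_clock \<epsilon> q \<le> 1" if "q \<le> 2"
    using that assms powr_le1[of "2 - q" \<epsilon>] zero_le_power2[of \<epsilon>] unfolding log_clock_def by linarith
  show "log_clock \<epsilon> q \<le> \<epsilon> powr (2 - q)" by (simp add: log_clock_def)
qed

lemma DERIV_powr_clock:
  fixes \<epsilon> q :: real
  assumes "\<epsilon> > 0"
  shows "DERIV (\<lambda>q. \<epsilon> powr (2 - q)) q :> ln (inverse \<epsilon>) * \<epsilon> powr (2 - q)"
proof -
  have "(\<lambda>q. \<epsilon> powr (2 - q)) = (\<lambda>q. exp ((2 - q) * ln \<epsilon>))" using assms by (simp add: powr_def)
  moreover have "DERIV (\<lambda>q. exp ((2 - q) * ln \<epsilon>)) q :> exp ((2 - q) * ln \<epsilon>) * - ln \<epsilon>"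
    by (auto intro!: derivative_eq_intros)
  ultimately show ?thesis using assms by (simp add: ln_inverse powr_def mult.commute)
qed

lemma abs_exp_minus_one_le:
  fixes m t :: real
  assumes "0 \<le> t" "t \<le> 1"
  shows "\<bar>exp (m * t) - 1\<bar> \<le> \<bar>m\<bar> * exp \<bar>m\<bar> * t"
proof -
  have "\<bar>exp u - 1\<bar> \<le> \<bar>u\<bar> * exp \<bar>u\<bar>" for u :: real
  proof (cases "u \<ge> 0")
    case True
    have "exp u - 1 = exp u * (1 - exp (- u))" by (simp add: algebra_simps flip: exp_add)
    also have "\<dots> \<le> exp u * u"
    proof (rule mult_left_mono)
      show "1 - exp (- u) \<le> u" using exp_ge_add_one_self[of "- u"] by linarith
    qed simp
    finally show ?thesis using True by (simp add: mult.commute)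
  next
    case False
    then have "\<bar>exp u - 1\<bar> = 1 - exp u" by simp
    also have "\<dots> \<le> - u" using exp_ge_add_one_self[of u] by linarith
    also have "\<dots> \<le> - u * exp (- u)" using False mult_left_mono[of 1 "exp (- u)" "- u"] by simp
    finally show ?thesis using False by simp
  qed
  from this[of "m * t"] have "\<bar>exp (m * t) - 1\<bar> \<le> \<bar>m\<bar> * t * exp (\<bar>m\<bar> * t)"
    using assms by (simp add: abs_mult)
  also have "\<dots> \<le> \<bar>m\<bar> * t * exp \<bar>m\<bar>"
    using assms by (intro mult_left_mono) (auto simp: mult_left_le)
  finally show ?thesis by (simp add: mult_ac)
qed

text \<open>Here \<open>H\<close> stands for the Gaussian mean of \<open>F'\<close> and \<open>m\<close> for the mass.\<close>

locale mean_slope_limit =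
  fixes H :: "real \<Rightarrow> real" and C :: real and p :: nat and K m :: real
  assumes H: "poly_lipschitz C p H" and H_ge: "\<And>b. - K \<le> H b" and K: "K \<ge> 0"
begin

definition rate :: "real \<Rightarrow> real \<Rightarrow> real" where
  "rate \<epsilon> t = 1 / (ln (inverse \<epsilon>) * (t + \<epsilon>\<^sup>2))"

text \<open>The inverse of \<open>log_clock\<close>: the primitive of \<open>rate\<close> that vanishes at time \<open>0\<close>.\<close>

definition clock :: "real \<Rightarrow> real \<Rightarrow> real" where
  "clock \<epsilon> t = (ln (t + \<epsilon>\<^sup>2) - ln (\<epsilon>\<^sup>2)) / ln (inverse \<epsilon>)"

lemma approximate_equation:
  assumes "0 < \<epsilon>" "\<epsilon> < 1"
  shows "slope_equation H C p K (rate \<epsilon>) (clock \<epsilon>) (\<lambda>t. exp (m * t))"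
proof
  have l: "ln (inverse \<epsilon>) > 0" using assms by (simp add: ln_inverse)
  have pos: "t + \<epsilon>\<^sup>2 > 0" if "t \<ge> 0" for t using that assms by (simp add: add_nonneg_pos)
  show "clock \<epsilon> 0 = 0" by (simp add: clock_def)
  show "(clock \<epsilon> has_real_derivative rate \<epsilon> t) (at t within {0..})" if "t \<ge> 0" for t
  proof -
    have "((\<lambda>t. ln (t + \<epsilon>\<^sup>2) - ln (\<epsilon>\<^sup>2)) has_real_derivative 1 / (t + \<epsilon>\<^sup>2)) (at t within {0..})"
    proof -
      have "((\<lambda>t. t + \<epsilon>\<^sup>2) has_real_derivative 1 + 0) (at t within {0..})"
        by (rule DERIV_add[OF DERIV_ident DERIV_const])
      from DERIV_diff[OF DERIV_chain2[OF DERIV_ln[OF pos[OF that]] this] DERIV_const[of "ln (\<epsilon>\<^sup>2)"]]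
      show ?thesis by (simp only: inverse_eq_divide add_0_right mult_1_right diff_0_right)
    qed
    note deriv = DERIV_cdivide[OF this, of "ln (inverse \<epsilon>)"]
    have "clock \<epsilon> = (\<lambda>t. (ln (t + \<epsilon>\<^sup>2) - ln (\<epsilon>\<^sup>2)) / ln (inverse \<epsilon>))"
      by (rule ext) (rule clock_def)
    moreover have "rate \<epsilon> t = 1 / (t + \<epsilon>\<^sup>2) / ln (inverse \<epsilon>)"
      by (simp only: rate_def divide_divide_eq_left mult.commute)
    ultimately show ?thesis using deriv by (simp only:)
  qed
  show "continuous_on {0..} (rate \<epsilon>)"
  proof -
    have "\<forall>t\<in>{0..}. ln (inverse \<epsilon>) * (t + \<epsilon>\<^sup>2) \<noteq> 0"
      using mult_pos_pos[OF l pos] by force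
    then show ?thesis unfolding rate_def by (intro continuous_intros)
  qed
  show "0 \<le> rate \<epsilon> t" if "t \<ge> 0" for t
    unfolding rate_def using mult_pos_pos[OF l pos[OF that]] by (intro divide_nonneg_pos) auto
  show "continuous_on {0..} (\<lambda>t. exp (m * t))" by (intro continuous_intros)
qed (rule H H_ge K exp_gt_zero)+

lemma limit_equation: "slope_equation H C p K (\<lambda>_. 1) (\<lambda>q. q) (\<lambda>_. 1)"
  by unfold_locales (use H H_ge K in \<open>auto intro!: derivative_eq_intros\<close>)

lemma clock_log_clock:
  assumes "0 < \<epsilon>" "\<epsilon> < 1"
  shows "clock \<epsilon> (log_clock \<epsilon> q) = q" "rate \<epsilon> (log_clock \<epsilon> q) * (ln (inverse \<epsilon>) * \<epsilon> powr (2 - q)) = 1"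
proof -
  have l: "ln \<epsilon> \<noteq> 0" "ln (inverse \<epsilon>) = - ln \<epsilon>" using assms by (auto simp: ln_inverse)
  show "clock \<epsilon> (log_clock \<epsilon> q) = q"
    using assms l by (simp add: clock_def log_clock_def ln_realpow ln_powr) (simp add: field_simps)
  show "rate \<epsilon> (log_clock \<epsilon> q) * (ln (inverse \<epsilon>) * \<epsilon> powr (2 - q)) = 1"
    using assms l by (simp add: rate_def log_clock_def)
qed

text \<open>The outcome of the Gronwall inequality on \<open>[0, 2]\<close>.  There \<open>B\<close> bounds both solutions, \<open>c\<close> bounds the
  massive factor, and \<open>R\<close> bounds the arguments of \<open>H\<close>.\<close>

definition error_constant :: real where
  "error_constant = (let B = exp (K * 2); c = exp \<bar>m\<bar>; R = c * B in
     exp ((C * (1 + R ^ p) * B * c + (\<bar>H 0\<bar> + C * (1 + R ^ p) * R)) * 2) *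
     (C * (1 + R ^ p) * B * (\<bar>m\<bar> * exp \<bar>m\<bar> * B)))"

text \<open>In the logarithmic clock the rate becomes \<open>1\<close>, and the massive factor differs from \<open>1\<close> by at most
  \<open>\<bar>m\<bar> e^\<bar>m\<bar> \<epsilon>^(2 - q)\<close>.  This is the derivative of \<open>\<bar>m\<bar> e^\<bar>m\<bar> \<epsilon>^(2 - q) / log(1/\<epsilon>)\<close>, which gains the factor
  \<open>1 / log(1/\<epsilon>)\<close>.\<close>

lemma solution_distance:
  assumes \<epsilon>: "0 < \<epsilon>" "\<epsilon> < 1"
    and \<sigma>: "slope_equation.solution H (rate \<epsilon>) (\<lambda>t. exp (m * t)) \<sigma>"
      "\<And>t. t \<ge> 0 \<Longrightarrow> 0 < \<sigma> t \<and> \<sigma> t \<le> exp (K * clock \<epsilon> t)"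
    and \<sigma>': "slope_equation.solution H (\<lambda>_. 1) (\<lambda>_. 1) \<sigma>'"
      "\<And>t. t \<ge> 0 \<Longrightarrow> 0 < \<sigma>' t \<and> \<sigma>' t \<le> exp (K * t)"
    and q: "0 \<le> q" "q \<le> 2"
  shows "\<bar>\<sigma> (log_clock \<epsilon> q) - \<sigma>' q\<bar> \<le> error_constant / ln (inverse \<epsilon>)"
proof -
  interpret approx: slope_equation H C p K "rate \<epsilon>" "clock \<epsilon>" "\<lambda>t. exp (m * t)"
    by (rule approximate_equation[OF \<epsilon>])
  interpret limit: slope_equation H C p K "\<lambda>_. 1" "\<lambda>q. q" "\<lambda>_. 1"
    by (rule limit_equation)
  define l where "l = ln (inverse \<epsilon>)"
  have l: "l > 0" using \<epsilon> by (simp add: l_def ln_inverse)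
  define B where "B = exp (K * 2)"
  define c where "c = exp \<bar>m\<bar>"
  define R where "R = c * B"
  define N where "N = C * (1 + R ^ p) * B * c + (\<bar>H 0\<bar> + C * (1 + R ^ p) * R)"
  define D where "D = C * (1 + R ^ p) * B * (\<bar>m\<bar> * exp \<bar>m\<bar> * B)"
  \<comment> \<open>A primitive of the forcing term \<open>D \<epsilon>^(2 - q)\<close>.\<close>
  define b where "b = (\<lambda>q. D / l * \<epsilon> powr (2 - q))"
  define x where "x = (\<lambda>q. \<sigma> (log_clock \<epsilon> q))"
  define k where "k = (\<lambda>q. exp (m * log_clock \<epsilon> q))"
  have C: "C \<ge> 0" using H by (simp add: poly_lipschitz_def)
  have B: "B \<ge> 1" and c: "c \<ge> 1" using K by (auto simp: B_def c_def)
  have R: "R \<ge> B" using B c by (simp add: R_def)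
  have N: "N \<ge> 0" and D: "D \<ge> 0" using C B R c by (auto simp: N_def D_def)
  have x_bound: "\<bar>x r\<bar> \<le> B" if "0 \<le> r" "r \<le> 2" for r
  proof -
    have "0 < x r \<and> x r \<le> exp (K * r)"
      using \<sigma>(2)[OF log_clock_bounds(1)[OF \<epsilon> that(1)]] by (simp add: x_def clock_log_clock[OF \<epsilon>])
    moreover have "exp (K * r) \<le> B" unfolding B_def using that K by (auto intro!: mult_left_mono)
    ultimately show ?thesis by simp
  qed
  have \<sigma>'_bound: "\<bar>\<sigma>' r\<bar> \<le> B" if "0 \<le> r" "r \<le> 2" for r
  proof -
    have "exp (K * r) \<le> B" unfolding B_def using that K by (auto intro!: mult_left_mono)
    then show ?thesis using \<sigma>'(2)[OF that(1)] by simp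
  qed
  have \<sigma>_deriv: "(\<sigma> has_real_derivative - (rate \<epsilon> t * (H (exp (m * t) * \<sigma> t) * \<sigma> t))) (at t within {0..})"
    if "t \<ge> 0" for t using \<sigma>(1) that by (simp add: approx.solution_def)
  have \<sigma>'_deriv: "(\<sigma>' has_real_derivative - (H (\<sigma>' t) * \<sigma>' t)) (at t within {0..})" if "t \<ge> 0" for t
    using \<sigma>'(1) that by (simp add: limit.solution_def)
  have clock_deriv: "DERIV (log_clock \<epsilon>) r :> l * \<epsilon> powr (2 - r)" for r
    unfolding log_clock_def l_def
    using DERIV_diff[OF DERIV_powr_clock[OF \<epsilon>(1), of r] DERIV_const[of "\<epsilon>\<^sup>2"]] by simp
  have interior: "at t within {0..} = at t" if "t > 0" for t :: real
    by (rule at_within_interior) (use that in auto)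
  have "\<bar>x q - \<sigma>' q\<bar> \<le> exp (N * q) * (\<bar>x 0 - \<sigma>' 0\<bar> + b q - b 0)"
  proof (rule gronwall[where Q = 2 and d' = "\<lambda>q. - (H (k q * x q) * x q) - - (H (\<sigma>' q) * \<sigma>' q)"
        and b' = "\<lambda>q. D * \<epsilon> powr (2 - q)"])
    have "continuous_on {0..2} (log_clock \<epsilon>)"
      by (rule DERIV_continuous_on[OF has_field_derivative_at_within[OF clock_deriv]])
    moreover have "continuous_on {0..} \<sigma>" by (rule DERIV_continuous_on[OF \<sigma>_deriv]) auto
    moreover have "log_clock \<epsilon> ` {0..2} \<subseteq> {0..}" by (auto intro: log_clock_bounds(1)[OF \<epsilon>])
    ultimately have "continuous_on {0..2} x"
      unfolding x_def by (intro continuous_on_compose2[of "{0..}" \<sigma> "{0..2}" "log_clock \<epsilon>"])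
    moreover have "continuous_on {0..2} \<sigma>'"
      using DERIV_continuous_on[OF \<sigma>'_deriv] by (rule continuous_on_subset) auto
    ultimately show "continuous_on {0..2} (\<lambda>q. x q - \<sigma>' q)" by (rule continuous_on_diff)
    show "continuous_on {0..2} b"
      unfolding b_def using \<epsilon> by (intro continuous_intros) auto
  next
    fix r :: real assume r: "0 < r" "r < 2"
    let ?t = "log_clock \<epsilon> r"
    have t: "?t > 0" by (rule log_clock_bounds(2)[OF \<epsilon> r(1)])
    have "DERIV x r :> - (rate \<epsilon> ?t * (H (exp (m * ?t) * \<sigma> ?t) * \<sigma> ?t)) * (l * \<epsilon> powr (2 - r))"
      unfolding x_def
      by (rule DERIV_chain2[OF _ clock_deriv]) (use \<sigma>_deriv[of ?t] t interior[OF t] in simp)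
    moreover have "- (rate \<epsilon> ?t * (H (exp (m * ?t) * \<sigma> ?t) * \<sigma> ?t)) * (l * \<epsilon> powr (2 - r)) =
        - ((rate \<epsilon> ?t * (l * \<epsilon> powr (2 - r))) * (H (k r * x r) * x r))"
      by (simp add: k_def x_def)
    ultimately have "DERIV x r :> - (H (k r * x r) * x r)"
      unfolding l_def clock_log_clock[OF \<epsilon>] by simp
    moreover have "DERIV \<sigma>' r :> - (H (\<sigma>' r) * \<sigma>' r)"
      using \<sigma>'_deriv[of r] r interior[of r] by simp
    ultimately show "DERIV (\<lambda>q. x q - \<sigma>' q) r :> - (H (k r * x r) * x r) - - (H (\<sigma>' r) * \<sigma>' r)"
      by (rule DERIV_diff)
    show "DERIV b r :> D * \<epsilon> powr (2 - r)"
      unfolding b_def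
      using DERIV_cmult[OF DERIV_powr_clock[OF \<epsilon>(1), of r], of "D / l"] l by (simp add: l_def)
    show "0 \<le> D * \<epsilon> powr (2 - r)" using D by simp
    have t1: "0 \<le> ?t" "?t \<le> 1" using t log_clock_bounds(3)[OF \<epsilon>, of r] r by auto
    have k: "0 < k r" "k r \<le> c"
    proof -
      have "m * ?t \<le> \<bar>m\<bar> * 1" using t1 by (intro mult_mono) auto
      then show "0 < k r" "k r \<le> c" by (auto simp: k_def c_def)
    qed
    have xb: "\<bar>x r\<bar> \<le> B" and \<sigma>b: "\<bar>\<sigma>' r\<bar> \<le> B" using x_bound \<sigma>'_bound r by auto
    have kx: "\<bar>k r * x r\<bar> \<le> R" unfolding R_def abs_mult using k xb by (intro mult_mono) auto
    have "\<bar>H (k r * x r) * x r - H (\<sigma>' r) * \<sigma>' r\<bar> \<le>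
        C * (1 + R ^ p) * B * \<bar>k r * x r - \<sigma>' r\<bar> + (\<bar>H 0\<bar> + C * (1 + R ^ p) * R) * \<bar>x r - \<sigma>' r\<bar>"
      using kx xb \<sigma>b R by (intro slope_term_lipschitz[OF H]) auto
    also have "\<bar>k r * x r - \<sigma>' r\<bar> \<le> c * \<bar>x r - \<sigma>' r\<bar> + \<bar>m\<bar> * exp \<bar>m\<bar> * B * \<epsilon> powr (2 - r)"
    proof -
      have "k r * x r - \<sigma>' r = k r * (x r - \<sigma>' r) + (k r - 1) * \<sigma>' r" by (simp add: algebra_simps)
      then have "\<bar>k r * x r - \<sigma>' r\<bar> \<le> \<bar>k r\<bar> * \<bar>x r - \<sigma>' r\<bar> + \<bar>k r - 1\<bar> * \<bar>\<sigma>' r\<bar>"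
        by (simp add: abs_mult[symmetric] abs_triangle_ineq)
      also have "\<bar>k r\<bar> * \<bar>x r - \<sigma>' r\<bar> \<le> c * \<bar>x r - \<sigma>' r\<bar>" using k by (intro mult_right_mono) auto
      also have "\<bar>k r - 1\<bar> * \<bar>\<sigma>' r\<bar> \<le> (\<bar>m\<bar> * exp \<bar>m\<bar> * \<epsilon> powr (2 - r)) * B"
      proof (rule mult_mono[OF _ \<sigma>b])
        have "\<bar>k r - 1\<bar> \<le> \<bar>m\<bar> * exp \<bar>m\<bar> * ?t" unfolding k_def by (rule abs_exp_minus_one_le[OF t1])
        also have "\<dots> \<le> \<bar>m\<bar> * exp \<bar>m\<bar> * \<epsilon> powr (2 - r)"
          by (intro mult_left_mono log_clock_bounds(4)[OF \<epsilon>]) auto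
        finally show "\<bar>k r - 1\<bar> \<le> \<bar>m\<bar> * exp \<bar>m\<bar> * \<epsilon> powr (2 - r)" .
      qed auto
      finally show ?thesis by (simp add: mult_ac)
    qed
    finally have "\<bar>H (k r * x r) * x r - H (\<sigma>' r) * \<sigma>' r\<bar> \<le>
        C * (1 + R ^ p) * B * (c * \<bar>x r - \<sigma>' r\<bar> + \<bar>m\<bar> * exp \<bar>m\<bar> * B * \<epsilon> powr (2 - r)) +
        (\<bar>H 0\<bar> + C * (1 + R ^ p) * R) * \<bar>x r - \<sigma>' r\<bar>"
      using C B R by (auto simp: mult_left_mono)
    then show "\<bar>- (H (k r * x r) * x r) - - (H (\<sigma>' r) * \<sigma>' r)\<bar> \<le> N * \<bar>x r - \<sigma>' r\<bar> + D * \<epsilon> powr (2 - r)"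
      by (simp add: N_def D_def algebra_simps abs_minus_commute)
  qed (use N q in auto)
  also have "x 0 = \<sigma>' 0"
    using \<sigma>(1) \<sigma>'(1) \<epsilon> by (simp add: x_def log_clock_def approx.solution_def limit.solution_def powr_numeral)
  also have "exp (N * q) * (\<bar>\<sigma>' 0 - \<sigma>' 0\<bar> + b q - b 0) \<le> exp (N * 2) * (D / l)"
  proof (rule mult_mono)
    show "exp (N * q) \<le> exp (N * 2)" using N q by (auto intro!: mult_left_mono)
    have mono: "\<epsilon> powr (2 - 0) \<le> \<epsilon> powr (2 - q)" "\<epsilon> powr (2 - q) \<le> 1"
      subgoal using \<epsilon> q by (intro powr_mono') auto
      subgoal using \<epsilon> q by (intro powr_le1) auto
      done
    have Dl: "D / l \<ge> 0" using D l by simp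
    have "b q \<le> D / l" "b 0 \<le> b q" "0 \<le> b 0"
      unfolding b_def using mult_left_mono[OF mono(2) Dl] mult_left_mono[OF mono(1) Dl]
        mult_nonneg_nonneg[OF Dl powr_ge_zero[of \<epsilon> "2 - 0"]] by auto
    then show "\<bar>\<sigma>' 0 - \<sigma>' 0\<bar> + b q - b 0 \<le> D / l" "0 \<le> \<bar>\<sigma>' 0 - \<sigma>' 0\<bar> + b q - b 0"
      by simp_all
  qed simp
  finally show ?thesis
    unfolding x_def error_constant_def Let_def N_def D_def R_def B_def c_def l_def times_divide_eq_right .
qed

end


section \<open>Convergence of the effective noise strength\<close>

theorem theorem1p4:
  fixes M :: "'w measure"
    and \<eta> :: "'w \<Rightarrow> (real \<times> real \<Rightarrow> real) \<Rightarrow> real"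
    and m :: real
    and F :: "real \<Rightarrow> real"
  assumes "white_noise M \<eta>"
    and "(\<lambda>t. F) \<in> class_S"
  shows "(\<forall>\<epsilon>\<in>{0<..<1}. \<forall>t\<ge>0. \<forall>a x y. mean_slope M \<eta> m F x \<epsilon> t a = mean_slope M \<eta> m F y \<epsilon> t a) \<and>
    (\<forall>x. \<exists>\<sigma> \<sigma>bar.
       (\<forall>\<epsilon>\<in>{0<..<1}. unique_solution (solves_sigma_eps M \<eta> m F x \<epsilon>) (\<sigma> \<epsilon>)) \<and>
       unique_solution (solves_sigma_bar M \<eta> F) \<sigma>bar \<and>
       ((\<lambda>\<epsilon>. SUP q\<in>{0..2}. \<bar>\<sigma> \<epsilon> (\<epsilon> powr (2 - q) - \<epsilon>\<^sup>2) - \<sigma>bar q\<bar>) \<longlongrightarrow> 0) (at_right 0))"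
proof -
  interpret white_noise_on_plane M \<eta>
    using assms(1) by (intro white_noise_on_plane.intro white_noise_on_plane_axioms.intro)
      (auto simp: white_noise_def)
  obtain C0 p K where F': "poly_lipschitz C0 p (deriv F)" and K: "K \<ge> 0" "\<And>u. - K \<le> deriv F u"
    and F: "\<And>u. F differentiable (at u)"
    using class_S_derivative[OF assms(2)] by metis
  have F'_meas: "deriv F \<in> borel_measurable borel"
    by (intro borel_measurable_continuous_onI poly_lipschitz_continuous[OF F'])
  define H where "H = gaussian_mean (deriv F)"
  obtain C where H: "poly_lipschitz C p H"
    using gaussian_mean_poly_lipschitz[OF F'] by (auto simp: H_def)
  interpret mean_slope_limit H C p K m
    by unfold_locales (use H K gaussian_mean_lower_bound[OF F' K(2)] in \<open>auto simp: H_def\<close>)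
  have slope: "mean_slope M \<eta> m F x \<epsilon> t a = 1 / (t + \<epsilon>\<^sup>2) * H (a * exp (m * t))"
    if "t \<ge> 0" "\<epsilon> \<in> {0<..<1}" for x t \<epsilon> a
    using that by (simp add: H_def mean_slope_eq_gaussian_mean[OF _ _ F F'_meas])
  have slope_bar: "(\<integral>\<omega>. deriv F (b * conv_distr (heat_kernel 1) (\<eta> \<omega>) 0) \<partial>M) = H b" for b
    using expectation_smoothed[OF _ F'_meas, of 1 b 0] by (simp add: H_def conv_distr_def smoothed_def)
  have eps_iff: "solves_sigma_eps M \<eta> m F x \<epsilon> = slope_equation.solution H (rate \<epsilon>) (\<lambda>t. exp (m * t))"
    if \<epsilon>: "\<epsilon> \<in> {0<..<1}" for x \<epsilon>
  proof -
    interpret slope_equation H C p K "rate \<epsilon>" "clock \<epsilon>" "\<lambda>t. exp (m * t)"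
      using \<epsilon> by (intro approximate_equation) auto
    show ?thesis
      unfolding fun_eq_iff solves_sigma_eps_def solution_def
      by (auto simp: slope[OF _ \<epsilon>] rate_def mult_ac)
  qed
  have bar_iff: "solves_sigma_bar M \<eta> F = slope_equation.solution H (\<lambda>_. 1) (\<lambda>_. 1)"
  proof -
    interpret slope_equation H C p K "\<lambda>_. 1" "\<lambda>q. q" "\<lambda>_. 1" by (rule limit_equation)
    show ?thesis by (auto simp: fun_eq_iff solves_sigma_bar_def solution_def slope_bar)
  qed
  obtain \<sigma>bar where \<sigma>bar: "unique_solution (slope_equation.solution H (\<lambda>_. 1) (\<lambda>_. 1)) \<sigma>bar"
    "\<And>t. t \<ge> 0 \<Longrightarrow> 0 < \<sigma>bar t \<and> \<sigma>bar t \<le> exp (K * t)"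
    using slope_equation.ex_unique_solution[OF limit_equation] by blast
  have "\<exists>\<sigma>. unique_solution (slope_equation.solution H (rate \<epsilon>) (\<lambda>t. exp (m * t))) \<sigma> \<and>
      (\<forall>t\<ge>0. 0 < \<sigma> t \<and> \<sigma> t \<le> exp (K * clock \<epsilon> t))" if "\<epsilon> \<in> {0<..<1}" for \<epsilon>
    using that by (intro slope_equation.ex_unique_solution[OF approximate_equation]) auto
  then obtain \<sigma> where \<sigma>: "\<And>\<epsilon>. \<epsilon> \<in> {0<..<1} \<Longrightarrow>
      unique_solution (slope_equation.solution H (rate \<epsilon>) (\<lambda>t. exp (m * t))) (\<sigma> \<epsilon>)"
    "\<And>\<epsilon> t. \<epsilon> \<in> {0<..<1} \<Longrightarrow> t \<ge> 0 \<Longrightarrow> 0 < \<sigma> \<epsilon> t \<and> \<sigma> \<epsilon> t \<le> exp (K * clock \<epsilon> t)"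
    by metis
  have dist: "\<bar>\<sigma> \<epsilon> (\<epsilon> powr (2 - q) - \<epsilon>\<^sup>2) - \<sigma>bar q\<bar> \<le> error_constant / ln (inverse \<epsilon>)"
    if "\<epsilon> \<in> {0<..<1}" "q \<in> {0..2}" for \<epsilon> q
    using solution_distance[of \<epsilon> "\<sigma> \<epsilon>" \<sigma>bar q] \<sigma>(1)[OF that(1)] \<sigma>(2)[OF that(1)] \<sigma>bar that
    by (auto simp: unique_solution_def log_clock_def)
  have "((\<lambda>\<epsilon>. SUP q\<in>{0..2}. \<bar>\<sigma> \<epsilon> (\<epsilon> powr (2 - q) - \<epsilon>\<^sup>2) - \<sigma>bar q\<bar>) \<longlongrightarrow> 0) (at_right 0)"
  proof (rule tendsto_sandwich)
    have ev: "\<forall>\<^sub>F \<epsilon> in at_right 0. \<epsilon> \<in> {0<..<1::real}"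
      by (rule eventually_at_right_real) simp
    show "\<forall>\<^sub>F \<epsilon> in at_right 0. 0 \<le> (SUP q\<in>{0..2}. \<bar>\<sigma> \<epsilon> (\<epsilon> powr (2 - q) - \<epsilon>\<^sup>2) - \<sigma>bar q\<bar>)"
      using ev
    proof eventually_elim
      case (elim \<epsilon>)
      have bdd: "bdd_above ((\<lambda>q. \<bar>\<sigma> \<epsilon> (\<epsilon> powr (2 - q) - \<epsilon>\<^sup>2) - \<sigma>bar q\<bar>) ` {0..2})"
        using dist[OF elim] by (intro bdd_aboveI2)
      show ?case by (rule cSUP_upper2[OF bdd, where x = 0]) auto
    qed
    show "\<forall>\<^sub>F \<epsilon> in at_right 0. (SUP q\<in>{0..2}. \<bar>\<sigma> \<epsilon> (\<epsilon> powr (2 - q) - \<epsilon>\<^sup>2) - \<sigma>bar q\<bar>) \<le>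
        error_constant / ln (inverse \<epsilon>)"
      using ev by eventually_elim (rule cSUP_least, auto intro: dist)
    have "filterlim (\<lambda>\<epsilon>::real. ln (inverse \<epsilon>)) at_top (at_right 0)"
      by (rule filterlim_compose[OF ln_at_top filterlim_inverse_at_top_right])
    then show "((\<lambda>\<epsilon>. error_constant / ln (inverse \<epsilon>)) \<longlongrightarrow> 0) (at_right 0)"
      by (intro tendsto_divide_0[OF tendsto_const] filterlim_at_top_imp_at_infinity)
  qed simp
  then show ?thesis
    using \<sigma>(1) \<sigma>bar(1) by (auto simp: slope eps_iff bar_iff intro!: exI[of _ \<sigma>] exI[of _ \<sigma>bar])
qed

end
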